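(* Let $X=\{X(n)\}_{n\ge 0}$ be the vertex occupation process of the interacting vertex-reinforced walks described in the context, with transition map $\pi:\mathcal D\to\mathcal D$, let $\mathrm{Fix}(\pi)=\{x\in\mathcal D: \pi(x)=x\}$, and let $\mathfrak L(X)=\bigcap_{n\ge0}\overline{\bigcup_{k\ge n}\{X(k)\}}$ be the (random) limit set of $X$. Then: (i) $\mathrm{Fix}(\pi)=\bigcup_{S\in\mathfrak V}\mathcal D(S)$, a finite union of connected sets (the empty set being regarded as connected). (ii) $\mathrm{Fix}(\pi)\neq\emptyset$. (iii) $\mathfrak L(X)$ is almost surely connected. (iv) $\mathbb P(\mathfrak L(X)\subset \mathrm{Fix}(\pi))=1$. (v) If $\det R_\rho(S)\neq0$ for all $S=(S^1,\dots,S^m)\in\mathfrak V$ with every $S^i$ nonempty, then $\mathrm{Fix}(\pi)$ is finite and $\sum_{x\in \mathrm{Fix}(\pi)}\mathbb P\big(\lim_{n\to\infty}X(n)=x\big)=1$.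
   Context: Model. Let $m\ge1$, $[m]=\{1,\dots,m\}$, let $V^1,\dots,V^m$ be nonempty finite sets, $V=\bigcup_i V^i$, $d^i=|V^i|$, $d=\sum_i d^i$, and $I_v=\{i\in[m]: v\in V^i\}$ for $v\in V$. Parameters: $\alpha>0$, $\eta_v^i>0$ ($v\in V$, $i\in I_v$), $\rho_v^{ij}\in\mathbb R$ ($v\in V$, $i,j\in I_v$) with $\rho_v^{ij}=\rho_v^{ji}$ and $\eta_v^i>\sum_{j\in I_v:\rho_v^{ij}<0}|\rho_v^{ij}|$. Let $\triangle^i$ be the simplex of probability vectors $(x_v^i)_{v\in V^i}$ and $\mathcal D=\triangle^1\times\cdots\times\triangle^m$, with points $x=(x_v^i)_{i\in[m],v\in V^i}$. Define $\pi=(\pi_v^i)_{i\in[m],v\in V^i}:\mathcal D\to\mathcal D$ by $$\pi_v^i(x)=\frac{x_v^iH_v^i(x)}{\sum_{w\in V^i}x_w^iH_w^i(x)},\qquad H_v^i(x)=\Big(\eta_v^i+\sum_{j\in I_v}\rho_v^{ij}x_v^j\Big)^\alpha .$$ The walks $W^i(n)\in V^i$, $n\ge1$, $i\in[m]$, are random variables on a probability space such that, with $X_v^i(0)=1/d^i$, $X_v^i(n)=\frac{1}{d^i+n}\big(1+\sum_{k=1}^n\mathbf 1\{W^i(k)=v\}\big)$, $X(n)=(X_v^i(n))_{i,v}\in\mathcal D$, and $\mathcal F_n$ the $\sigma$-field generated by $W^i(k)$, $i\in[m]$, $1\le k\le n$ ($\mathcal F_0$ trivial), one has $\mathbb P(W^i(n+1)=v\mid\mathcal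 F_n)=\pi_v^i(X(n))$ for all $n\ge0$, and $W^1(n+1),\dots,W^m(n+1)$ are conditionally independent given $\mathcal F_n$. Fixed-point systems. Let $\mathfrak V=\mathcal P(V^1)\times\cdots\times\mathcal P(V^m)$ ($\mathcal P$ = power set). For $S=(S^1,\dots,S^m)\in\mathfrak V$ consider the linear system in the real unknowns $x_v^i$ ($i\in[m]$, $v\in V^i$): for all $i\in[m]$, $$\eta_v^i+\sum_{j\in I_v}\rho_v^{ij}x_v^j=\eta_w^i+\sum_{j\in I_w}\rho_w^{ij}x_w^j\ \ \forall v,w\in S^i,\qquad \sum_{\ell\in S^i}x_\ell^i=1,\qquad x_u^i=0\ \ \forall u\in V^i\setminus S^i .$$ $\mathcal D(S)$ is the set of solutions $x\in\mathbb R^d$ of this system with $x_v^i>0$ for all $i\in[m]$, $v\in S^i$. If all $S^i$ are nonempty, choose $b^i\in S^i$ for each $i$; the system is then equivalent to the $d$ equations consisting, for each $i$, of the $|S^i|-1$ equations with $w=b^i$, $v\in S^i\setminus\{b^i\}$, the normalisation equation, and the $d^i-|S^i|$ equations $x_u^i=0$. $R_\rho(S)$ is the $d\times d$ coefficient matrix of this system (whether its determinant vanishes does not depend on the choice of the $b^i$ or on the order of equations). *)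

theory Defs
  imports "HOL-Probability.Probability" "Jordan_Normal_Form.Determinant"
begin

text \<open>
  Conventions.  The walks are indexed by \<open>{1..m}\<close>; the vertex sets are \<open>V :: nat \<Rightarrow> 'v set\<close>.
  The quantities written with walk indices \<open>i, j\<close> as superscripts and a vertex \<open>v\<close> as subscript
  are rendered as \<open>x i v\<close>, \<open>\<eta> i v\<close>, \<open>\<rho> i j v\<close>.

  A point of \<open>d\<close>-dimensional real space (coordinates indexed by the pairs \<open>(i, v)\<close> with
  \<open>v \<in> V i\<close>) is a function \<open>nat \<Rightarrow> 'v \<Rightarrow> real\<close> vanishing off those pairs.  The subspace topology
  inherited from the product topology on functions is then the Euclidean one.
\<close>

definition walks_at :: "nat \<Rightarrow> (nat \<Rightarrow> 'v set) \<Rightarrow> 'v \<Rightarrow> nat set" where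
  "walks_at m V v = {i \<in> {1..m}. v \<in> V i}"

definition coords :: "nat \<Rightarrow> (nat \<Rightarrow> 'v set) \<Rightarrow> (nat \<times> 'v) set" where
  "coords m V = Sigma {1..m} V"

definition coord_space :: "nat \<Rightarrow> (nat \<Rightarrow> 'v set) \<Rightarrow> (nat \<Rightarrow> 'v \<Rightarrow> real) set" where
  "coord_space m V = {x. \<forall>i v. (i, v) \<notin> coords m V \<longrightarrow> x i v = 0}"

definition simplex_prod :: "nat \<Rightarrow> (nat \<Rightarrow> 'v set) \<Rightarrow> (nat \<Rightarrow> 'v \<Rightarrow> real) set" where
  "simplex_prod m V =
     {x \<in> coord_space m V. \<forall>i\<in>{1..m}. (\<forall>v\<in>V i. 0 \<le> x i v) \<and> (\<Sum>v\<in>V i. x i v) = 1}"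

definition affine_weight ::
  "nat \<Rightarrow> (nat \<Rightarrow> 'v set) \<Rightarrow> (nat \<Rightarrow> 'v \<Rightarrow> real) \<Rightarrow> (nat \<Rightarrow> nat \<Rightarrow> 'v \<Rightarrow> real) \<Rightarrow>
   (nat \<Rightarrow> 'v \<Rightarrow> real) \<Rightarrow> nat \<Rightarrow> 'v \<Rightarrow> real" where
  "affine_weight m V \<eta> \<rho> x i v = \<eta> i v + (\<Sum>j\<in>walks_at m V v. \<rho> i j v * x j v)"

definition weight ::
  "nat \<Rightarrow> (nat \<Rightarrow> 'v set) \<Rightarrow> real \<Rightarrow> (nat \<Rightarrow> 'v \<Rightarrow> real) \<Rightarrow> (nat \<Rightarrow> nat \<Rightarrow> 'v \<Rightarrow> real) \<Rightarrow>
   (nat \<Rightarrow> 'v \<Rightarrow> real) \<Rightarrow> nat \<Rightarrow> 'v \<Rightarrow> real" where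
  "weight m V \<alpha> \<eta> \<rho> x i v = affine_weight m V \<eta> \<rho> x i v powr \<alpha>"

definition transition ::
  "nat \<Rightarrow> (nat \<Rightarrow> 'v set) \<Rightarrow> real \<Rightarrow> (nat \<Rightarrow> 'v \<Rightarrow> real) \<Rightarrow> (nat \<Rightarrow> nat \<Rightarrow> 'v \<Rightarrow> real) \<Rightarrow>
   (nat \<Rightarrow> 'v \<Rightarrow> real) \<Rightarrow> nat \<Rightarrow> 'v \<Rightarrow> real" where
  "transition m V \<alpha> \<eta> \<rho> x i v =
     (if (i, v) \<in> coords m V
      then x i v * weight m V \<alpha> \<eta> \<rho> x i v / (\<Sum>w\<in>V i. x i w * weight m V \<alpha> \<eta> \<rho> x i w)
      else 0)"

definition fixed_points ::
  "nat \<Rightarrow> (nat \<Rightarrow> 'v set) \<Rightarrow> real \<Rightarrow> (nat \<Rightarrow> 'v \<Rightarrow> real) \<Rightarrow> (nat \<Rightarrow> nat \<Rightarrow> 'v \<Rightarrow> real) \<Rightarrow>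
   (nat \<Rightarrow> 'v \<Rightarrow> real) set" where
  "fixed_points m V \<alpha> \<eta> \<rho> = {x \<in> simplex_prod m V. transition m V \<alpha> \<eta> \<rho> x = x}"

definition supports :: "nat \<Rightarrow> (nat \<Rightarrow> 'v set) \<Rightarrow> (nat \<Rightarrow> 'v set) set" where
  "supports m V = (\<Pi>\<^sub>E i\<in>{1..m}. Pow (V i))"

definition positive_solutions ::
  "nat \<Rightarrow> (nat \<Rightarrow> 'v set) \<Rightarrow> (nat \<Rightarrow> 'v \<Rightarrow> real) \<Rightarrow> (nat \<Rightarrow> nat \<Rightarrow> 'v \<Rightarrow> real) \<Rightarrow>
   (nat \<Rightarrow> 'v set) \<Rightarrow> (nat \<Rightarrow> 'v \<Rightarrow> real) set" where
  "positive_solutions m V \<eta> \<rho> S =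
     {x \<in> coord_space m V. \<forall>i\<in>{1..m}.
        (\<forall>v\<in>S i. \<forall>w\<in>S i. affine_weight m V \<eta> \<rho> x i v = affine_weight m V \<eta> \<rho> x i w) \<and>
        (\<Sum>l\<in>S i. x i l) = 1 \<and>
        (\<forall>u\<in>V i - S i. x i u = 0) \<and>
        (\<forall>v\<in>S i. x i v > 0)}"

text \<open>
  The \<open>d\<close> equations equivalent to the system, given base points \<open>b i \<in> S i\<close>, are indexed by the same
  pairs as the unknowns: row \<open>(i, v)\<close> is the equation \<open>x i v = 0\<close> if \<open>v \<notin> S i\<close>, the normalisation
  equation of walk \<open>i\<close> if \<open>v = b i\<close>, and the equality of the affine weights at \<open>v\<close> and \<open>b i\<close>
  otherwise.  The column \<open>(j, u)\<close> is the coefficient of the unknown \<open>x j u\<close>; as \<open>u \<in> V j\<close>, the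
  condition \<open>u = v\<close> entails that \<open>j\<close> is one of the walks at \<open>v\<close>.
\<close>

definition system_coeff ::
  "(nat \<Rightarrow> nat \<Rightarrow> 'v \<Rightarrow> real) \<Rightarrow> (nat \<Rightarrow> 'v) \<Rightarrow> (nat \<Rightarrow> 'v set) \<Rightarrow>
   nat \<times> 'v \<Rightarrow> nat \<times> 'v \<Rightarrow> real" where
  "system_coeff \<rho> b S = (\<lambda>(i, v) (j, u).
     if v \<notin> S i then (if (j, u) = (i, v) then 1 else 0)
     else if v = b i then (if j = i \<and> u \<in> S i then 1 else 0)
     else (if u = v then \<rho> i j v else 0) - (if u = b i then \<rho> i j (b i) else 0))"

text \<open>
  Rows and columns are listed in one common arbitrary order of the coordinates; the determinant does
  not depend on it.
\<close>

definition system_matrix ::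
  "nat \<Rightarrow> (nat \<Rightarrow> 'v set) \<Rightarrow> (nat \<Rightarrow> nat \<Rightarrow> 'v \<Rightarrow> real) \<Rightarrow> (nat \<Rightarrow> 'v) \<Rightarrow> (nat \<Rightarrow> 'v set) \<Rightarrow>
   real Matrix.mat" where
  "system_matrix m V \<rho> b S =
     Matrix.mat (card (coords m V)) (card (coords m V))
       (\<lambda>(r, c). system_coeff \<rho> b S (from_nat_into (coords m V) r) (from_nat_into (coords m V) c))"

text \<open>At \<open>n = 0\<close> the sum is empty and the value is \<open>1 / card (V i)\<close>.\<close>

definition occupation ::
  "nat \<Rightarrow> (nat \<Rightarrow> 'v set) \<Rightarrow> (nat \<Rightarrow> nat \<Rightarrow> 'w \<Rightarrow> 'v) \<Rightarrow> nat \<Rightarrow> 'w \<Rightarrow> nat \<Rightarrow> 'v \<Rightarrow> real" where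
  "occupation m V W n \<omega> i v =
     (if (i, v) \<in> coords m V
      then (1 + (\<Sum>k=1..n. of_bool (W i k \<omega> = v))) / real (card (V i) + n)
      else 0)"

definition walk_history ::
  "'w measure \<Rightarrow> nat \<Rightarrow> (nat \<Rightarrow> 'v set) \<Rightarrow> (nat \<Rightarrow> nat \<Rightarrow> 'w \<Rightarrow> 'v) \<Rightarrow> nat \<Rightarrow> 'w measure" where
  "walk_history M m V W n =
     sigma (space M) {W i k -` A \<inter> space M | i k A. i \<in> {1..m} \<and> k \<in> {1..n} \<and> A \<subseteq> V i}"

text \<open>The analogue of \<^const>\<open>prob_space.indep_vars\<close> relative to a sub-\<open>\<sigma>\<close>-algebra \<open>F\<close>.\<close>

definition cond_indep_vars ::
  "'w measure \<Rightarrow> 'w measure \<Rightarrow> ('i \<Rightarrow> 'b measure) \<Rightarrow> ('i \<Rightarrow> 'w \<Rightarrow> 'b) \<Rightarrow> 'i set \<Rightarrow> bool" where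
  "cond_indep_vars M F N Y I \<longleftrightarrow>
     (\<forall>i\<in>I. Y i \<in> measurable M (N i)) \<and>
     (\<forall>J\<subseteq>I. J \<noteq> {} \<longrightarrow> finite J \<longrightarrow> (\<forall>A\<in>(\<Pi> j\<in>J. sets (N j)).
        AE \<omega> in M.
          real_cond_exp M F (indicat_real (\<Inter>j\<in>J. Y j -` A j \<inter> space M)) \<omega> =
          (\<Prod>j\<in>J. real_cond_exp M F (indicat_real (Y j -` A j \<inter> space M)) \<omega>)))"

definition limit_set :: "(nat \<Rightarrow> 'a::topological_space) \<Rightarrow> 'a set" where
  "limit_set y = (\<Inter>n. closure (\<Union>k\<in>{n..}. {y k}))"

end

theory Submission
  imports Defs
begin

text \<open>
  Let \<open>h\<close> be the affine weights and \<open>L\<close> the quadratic potential with gradient \<open>h\<close>.  In mean, \<open>L\<close> increases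
  along the process by about \<open>1 / n\<close> times a sum of covariances of \<open>h\<close> and \<open>h powr \<alpha>\<close> under the
  current distributions.  This sum dominates a multiple of the spread
  \<open>Q x = (\<Sum>i. \<Sum>v w. x i v * x i w * (h x i v - h x i w)\<^sup>2)\<close>, which vanishes exactly at the fixed points.
  As \<open>L\<close> is bounded, \<open>(\<Sum>n. Q (X n) / n)\<close> has finite expectation, so it converges almost surely;
  since \<open>Q (X n)\<close> moves by \<open>O(1 / n)\<close> in each step, this forces \<open>Q (X n)\<close> to tend to \<open>0\<close>.  Hence the
  limit set consists of fixed points.
\<close>

text \<open>The covariances are nonnegative because a power with exponent \<alpha> > 0 is
  increasing, and they dominate variances because the condition on \<eta> and \<rho> keeps the
  affine weights in a compact interval of positive numbers. Two further points shape the proof. The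
  walks have different step sizes \<open>1 / (card (V i) + n + 1)\<close>, so the drift is bounded
  walk by walk before the step sizes are replaced by a common lower bound. And points are functions
  on an arbitrary vertex type, whose product topology is not metrizable for uncountable types, while
  limit sets are studied by subsequences and distances; a closed embedding of the finitely many
  coordinates into real sequences carries the results over.

  Describing the fixed points as the zero set of the continuous function Q also makes the event in
  (iv) measurable: it is the event that Q (X n) tends to 0. A fixed point is found in the nonempty
  limit set of a trajectory. If the fixed points are finitely many, connectedness leaves a single
  limit point, and compactness turns it into a limit.\<close>

section \<open>Limit sets of sequences\<close>

lemma closed_limit_set: "closed (limit_set y)"
  by (auto simp: limit_set_def)

lemma limit_set_subset:
  assumes "closed C" "\<And>n. n \<ge> N \<Longrightarrow> y n \<in> C"
  shows "limit_set y \<subseteq> C"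
proof -
  have "closure (\<Union>k\<in>{N..}. {y k}) \<subseteq> C"
    using assms by (intro closure_minimal) auto
  then show ?thesis by (auto simp: limit_set_def)
qed

lemma subseq_limit_in_limit_set:
  assumes "strict_mono r" "(\<lambda>k. y (r k)) \<longlonglongrightarrow> l"
  shows "l \<in> limit_set y"
  unfolding limit_set_def
proof
  fix n
  show "l \<in> closure (\<Union>k\<in>{n..}. {y k})"
  proof (rule Lim_in_closed_set[OF closed_closure _ _ assms(2)])
    show "\<forall>\<^sub>F k in sequentially. y (r k) \<in> closure (\<Union>k\<in>{n..}. {y k})"
      using eventually_ge_at_top[of n]
    proof eventually_elim
      case (elim k)
      then have "n \<le> r k" using seq_suble[OF assms(1), of k] by linarith
      then show ?case by (intro closure_subset[THEN subsetD]) auto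
    qed
  qed simp
qed

text \<open>A closed map commutes with closure, and injectivity lets the image commute with the
  intersection over \<open>n\<close>. This moves limit sets between the coordinate space and the
  space of real sequences.\<close>

lemma limit_set_image:
  assumes Z: "closed Z" "\<And>n. y n \<in> Z"
    and f: "continuous_on Z f" "inj_on f Z" "\<And>C. closed C \<Longrightarrow> C \<subseteq> Z \<Longrightarrow> closed (f ` C)"
  shows "limit_set (\<lambda>n. f (y n)) = f ` limit_set y"
proof -
  let ?T = "\<lambda>n. \<Union>k\<in>{n..}. {y k}"
  have sub: "closure (?T n) \<subseteq> Z" for n
    using Z by (intro closure_minimal) auto
  have T_sub: "?T n \<subseteq> closure (?T n)" for n by (rule closure_subset)
  have "closure (f ` ?T n) = f ` closure (?T n)" for n
  proof
    show "closure (f ` ?T n) \<subseteq> f ` closure (?T n)"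
      by (intro closure_minimal image_mono T_sub f(3) closed_closure sub)
    show "f ` closure (?T n) \<subseteq> closure (f ` ?T n)"
      using continuous_on_subset[OF f(1) sub] by (intro image_closure_subset closure_subset closed_closure)
  qed
  moreover have "f ` (\<Inter>n. closure (?T n)) = (\<Inter>n. f ` closure (?T n))"
    using sub by (intro image_INT[OF f(2)]) auto
  moreover have "(\<Union>k\<in>{n..}. {f (y k)}) = f ` ?T n" for n by auto
  ultimately show ?thesis by (simp add: limit_set_def)
qed

section \<open>Limit sets of sequences in a compact subset of a metric space\<close>

context
  fixes y :: "nat \<Rightarrow> 'a :: metric_space" and K :: "'a set"
  assumes K: "compact K" "\<And>n. y n \<in> K"
begin

lemma limit_set_nonempty: "limit_set y \<noteq> {}"
proof -
  obtain l r where "strict_mono r" "(y \<circ> r) \<longlonglongrightarrow> l"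
    using K by (metis compact_def seq_compact_def compact_eq_seq_compact_metric)
  then show ?thesis using subseq_limit_in_limit_set[of r y l] by (auto simp: o_def)
qed

lemma compact_limit_set: "compact (limit_set y)"
  using limit_set_subset[of K 0 y] K closed_limit_set compact_imp_closed
  by (metis compact_Int_closed inf.absorb_iff2)

lemma infinite_visits_limit_set:
  fixes P :: "nat \<Rightarrow> bool"
  assumes "infinite {n. P n}"
  obtains r l where "strict_mono r" "\<And>k. P (r k)" "(\<lambda>k. y (r k)) \<longlonglongrightarrow> l" "l \<in> limit_set y"
proof -
  obtain q :: "nat \<Rightarrow> nat" where q: "strict_mono q" "\<And>k. q k \<in> {n. P n}"
    using infinite_enumerate[OF assms] by blast
  obtain l s where s: "strict_mono s" "((y \<circ> q) \<circ> s) \<longlonglongrightarrow> l"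
    using K by (metis comp_apply seq_compact_def compact_eq_seq_compact_metric)
  have "strict_mono (q \<circ> s)" using q s by (simp add: strict_mono_o)
  then show ?thesis
    using that[of "q \<circ> s" l] q s subseq_limit_in_limit_set[of "q \<circ> s" y l] by (auto simp: o_def)
qed

text \<open>Infinitely many visits to the closed complement of \<open>U\<close> would accumulate
  there, at a point of the limit set.\<close>

lemma eventually_near_limit_set:
  assumes "open U" "limit_set y \<subseteq> U"
  shows "eventually (\<lambda>n. y n \<in> U) sequentially"
proof (rule ccontr)
  assume "\<not> ?thesis"
  then have "infinite {n. y n \<notin> U}"
    by (simp add: INFM_iff_infinite frequently_cofinite[symmetric] cofinite_eq_sequentially not_eventually)
  then obtain r l where "\<And>k. y (r k) \<in> - U" "(\<lambda>k. y (r k)) \<longlonglongrightarrow> l" "l \<in> limit_set y"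
    by (rule infinite_visits_limit_set) auto
  then have "l \<in> - U"
    using \<open>open U\<close> by (intro Lim_in_closed_set[of "-U" "\<lambda>k. y (r k)" sequentially l]) auto
  then show False using \<open>l \<in> limit_set y\<close> assms by auto
qed

text \<open>If the limit set split into two closed pieces, disjoint open neighbourhoods
  \<open>U\<close> and \<open>V\<close> would eventually contain the sequence, which would jump from
  \<open>U\<close> to \<open>V\<close> infinitely often. As the steps vanish, a limit of such
  departure points is also a limit of the arrival points, hence lies outside both \<open>U\<close>
  and \<open>V\<close>.\<close>

lemma connected_limit_set:
  assumes "(\<lambda>n. dist (y (Suc n)) (y n)) \<longlonglongrightarrow> 0"
  shows "connected (limit_set y)"
proof (rule ccontr)
  assume "\<not> ?thesis"
  then obtain A B where AB: "closed A" "closed B" "A \<noteq> {}" "B \<noteq> {}" "A \<union> B = limit_set y" "A \<inter> B = {}"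
    unfolding connected_closed_set[OF closed_limit_set] by auto
  have "compact A" "compact B"
    using compact_limit_set AB by (metis compact_Int_closed inf.absorb_iff2 sup_ge1 sup_ge2)+
  then obtain U V where UV: "open U" "open V" "A \<subseteq> U" "B \<subseteq> V" "U \<inter> V = {}"
    using Hausdorff_space_compact_separation[of euclidean A B] AB(6) by (auto simp: disjnt_def)
  have ev: "eventually (\<lambda>n. y n \<in> U \<union> V) sequentially"
    using UV AB by (intro eventually_near_limit_set) auto
  \<comment> \<open>With finitely many crossings, a late visit to \<open>U\<close> would confine the
    sequence to \<open>U\<close> for ever, although the points of \<open>B\<close> require visits to
    \<open>V\<close>.\<close>
  have "infinite {n. y n \<in> U \<and> y (Suc n) \<in> V}"
  proof
    assume "finite {n. y n \<in> U \<and> y (Suc n) \<in> V}"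
    then have "eventually (\<lambda>n. \<not> (y n \<in> U \<and> y (Suc n) \<in> V)) sequentially"
      by (simp add: eventually_cofinite cofinite_eq_sequentially[symmetric])
    with ev obtain N where N: "\<And>n. n \<ge> N \<Longrightarrow> y n \<in> U \<union> V \<and> \<not> (y n \<in> U \<and> y (Suc n) \<in> V)"
      by (metis (mono_tags, lifting) eventually_conj eventually_sequentially)
    have freq: "\<exists>n\<ge>N'. y n \<in> O'" if O': "open O'" "a \<in> O'" "a \<in> limit_set y" for O' a N'
    proof (rule ccontr)
      assume "\<not> ?thesis"
      then have "limit_set y \<subseteq> - O'" using O' by (intro limit_set_subset[of _ N']) auto
      then show False using O' by auto
    qed
    obtain x where "x \<in> A" using AB by blast
    then have "x \<in> U" "x \<in> limit_set y" using AB UV by auto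
    then obtain n0 where n0: "n0 \<ge> N" "y n0 \<in> U" using freq[of U x N] UV by auto
    have "y n \<in> U" if "n \<ge> n0" for n
      using that
    proof (induction n rule: dec_induct)
      case (step k)
      then show ?case using N[of k] N[of "Suc k"] n0 by auto
    qed (use n0 in auto)
    moreover obtain z where "z \<in> B" using AB by blast
    then have "z \<in> V" "z \<in> limit_set y" using AB UV by auto
    then obtain n1 where "n1 \<ge> n0" "y n1 \<in> V" using freq[of V z n0] UV by auto
    ultimately show False using UV by (metis disjoint_iff)
  qed
  then obtain r l where r: "strict_mono r" "\<And>k. y (r k) \<in> U \<and> y (Suc (r k)) \<in> V"
      "(\<lambda>k. y (r k)) \<longlonglongrightarrow> l" "l \<in> limit_set y"
    by (rule infinite_visits_limit_set) auto
  have "(\<lambda>k. dist (y (Suc (r k))) (y (r k))) \<longlonglongrightarrow> 0"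
    using LIMSEQ_subseq_LIMSEQ[OF assms r(1)] by (simp add: o_def)
  from tendsto_add[OF this r(3)[unfolded tendsto_dist_iff[of _ l]]]
  have "(\<lambda>k. dist (y (Suc (r k))) (y (r k)) + dist (y (r k)) l) \<longlonglongrightarrow> 0" by simp
  then have "(\<lambda>k. dist (y (Suc (r k))) l) \<longlonglongrightarrow> 0"
    by (rule Lim_null_comparison[rotated]) (simp add: dist_triangle)
  then have "(\<lambda>k. y (Suc (r k))) \<longlonglongrightarrow> l" by (simp add: tendsto_dist_iff[of _ l])
  moreover have "eventually (\<lambda>k. y (Suc (r k)) \<in> - U) sequentially"
    using r(2) UV by (intro always_eventually) blast
  ultimately have "l \<in> - U"
    using UV by (intro Lim_in_closed_set[of "-U" "\<lambda>k. y (Suc (r k))" sequentially l]) auto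
  moreover have "eventually (\<lambda>k. y (r k) \<in> - V) sequentially"
    using r(2) UV by (intro always_eventually) blast
  then have "l \<in> - V"
    using r(3) UV by (intro Lim_in_closed_set[of "-V" "\<lambda>k. y (r k)" sequentially l]) auto
  ultimately show False using r(4) AB UV by blast
qed

lemma tendsto_limit_set_singleton:
  assumes "limit_set y = {l}"
  shows "y \<longlonglongrightarrow> l"
  using eventually_near_limit_set assms by (auto simp: tendsto_def)

end

lemma tendsto_fun_iff:
  fixes f :: "'a \<Rightarrow> 'b \<Rightarrow> 'c :: topological_space"
  shows "(f \<longlongrightarrow> l) F \<longleftrightarrow> (\<forall>i. ((\<lambda>x. f x i) \<longlongrightarrow> l i) F)"
  using limitin_componentwise[of "\<lambda>_. euclidean :: 'c topology" UNIV f l F]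
  by (simp add: euclidean_product_topology)

section \<open>Null sequences from slow variation\<close>

text \<open>The increments of \<open>q\<^sup>2\<close> are summable, so \<open>q\<close> converges, and its limit is \<open>0\<close> because the
  harmonic series diverges.\<close>
lemma tendsto_0_if_harmonic_sum:
  fixes q :: "nat \<Rightarrow> real"
  assumes q0: "\<And>n. q n \<ge> 0" and K: "\<And>n. \<bar>q (Suc n) - q n\<bar> \<le> K / real (N + Suc n)"
    and sm: "summable (\<lambda>n. q n / real (N + Suc n))"
  shows "q \<longlonglongrightarrow> 0"
proof -
  define g where "g n = 1 / real (N + Suc n)" for n
  have g: "g n > 0" for n by (simp add: g_def)
  have "K / real (N + 1) \<ge> 0" using K[of 0] by simp
  then have "K \<ge> 0" by (simp add: zero_le_divide_iff)
  have "summable (\<lambda>n. 1 / real (Suc n) ^ 2)"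
    using inverse_squares_sums by (auto simp: sums_iff add.commute)
  then have g2: "summable (\<lambda>n. g n ^ 2)"
    by (rule summable_comparison_test') (auto simp: g_def power_divide intro!: divide_left_mono power_mono)
  \<comment> \<open>The increments of \<open>q\<close> itself are only known to be of order 1 / n.
    Squaring supplies an extra factor of size \<open>2 * q n + K * g n\<close>, and both resulting
    terms are summable.\<close>
  have "summable (\<lambda>n. q (Suc n) ^ 2 - q n ^ 2)"
  proof (rule summable_comparison_test')
    show "summable (\<lambda>n. 2 * K * (q n * g n) + K^2 * g n ^ 2)"
      using sm g2 by (intro summable_add summable_mult) (auto simp: g_def)
    fix n :: nat
    have d: "\<bar>q (Suc n) - q n\<bar> \<le> K * g n" using K[of n] by (simp add: g_def)
    have "norm (q (Suc n) ^ 2 - q n ^ 2) = \<bar>q (Suc n) - q n\<bar> * (q (Suc n) + q n)"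
      using q0[of n] q0[of "Suc n"] by (simp add: power2_eq_square square_diff_square_factored abs_mult)
    also have "\<dots> \<le> (K * g n) * (2 * q n + K * g n)"
      using d q0[of n] q0[of "Suc n"] g[of n] \<open>K \<ge> 0\<close> by (intro mult_mono) auto
    finally show "norm (q (Suc n) ^ 2 - q n ^ 2) \<le> 2 * K * (q n * g n) + K^2 * g n ^ 2"
      by (simp add: algebra_simps power2_eq_square)
  qed
  then have "(\<lambda>n. \<Sum>k<n. q (Suc k) ^ 2 - q k ^ 2) \<longlonglongrightarrow> (\<Sum>k. q (Suc k) ^ 2 - q k ^ 2)"
    by (rule summable_LIMSEQ)
  then have "(\<lambda>n. q n ^ 2 - q 0 ^ 2) \<longlonglongrightarrow> (\<Sum>k. q (Suc k) ^ 2 - q k ^ 2)"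
    by (simp only: sum_lessThan_telescope[of "\<lambda>n. q n ^ 2"])
  from tendsto_add[OF this tendsto_const[of "q 0 ^ 2"]]
  obtain l where "(\<lambda>n. q n ^ 2) \<longlonglongrightarrow> l" by auto
  then have "(\<lambda>n. sqrt (q n ^ 2)) \<longlonglongrightarrow> sqrt l" by (rule tendsto_real_sqrt)
  then have lim: "q \<longlonglongrightarrow> sqrt l" using q0 by simp
  have "sqrt l = 0"
  proof (rule ccontr)
    assume "sqrt l \<noteq> 0"
    then have pos: "sqrt l > 0" using LIMSEQ_le_const[OF lim, of 0] q0 by force
    then have "eventually (\<lambda>n. q n > sqrt l / 2) sequentially"
      using order_tendstoD(1)[OF lim, of "sqrt l / 2"] by simp
    then obtain n0 where n0: "\<And>n. n \<ge> n0 \<Longrightarrow> q n > sqrt l / 2" by (auto simp: eventually_sequentially)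
    have "summable (\<lambda>n. (sqrt l / 2) * g n)"
    proof (rule summable_comparison_test'[of _ n0])
      show "summable (\<lambda>n. q n * g n)" using sm by (simp add: g_def)
      fix n assume "n \<ge> n0"
      then show "norm (sqrt l / 2 * g n) \<le> q n * g n"
        using n0[of n] g[of n] pos by (simp add: abs_mult)
    qed
    then have "summable g" using pos by (simp add: summable_cmult_iff)
    then have "summable (\<lambda>n. 1 / real (n + Suc N))"
      by (simp add: g_def[abs_def] ac_simps)
    then have "summable (\<lambda>n. 1 / real n)" using summable_iff_shift[of "\<lambda>n. 1 / real n"] by blast
    then show False using not_summable_harmonic[where 'a = real] by (simp add: inverse_eq_divide)
  qed
  then show ?thesis using lim by simp
qed

section \<open>The interaction model\<close>

text \<open>The mean value theorem bounds difference quotients below by the least derivative on the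
  interval. The derivative \<open>\<alpha> * z powr (\<alpha> - 1)\<close> is monotone in
  \<open>z\<close>, in a direction that depends on whether \<alpha> \<ge> 1, so its minimum is
  attained at an endpoint; \<mu> covers both cases.\<close>

lemma powr_diff_mult_diff_ge:
  fixes \<alpha> :: real
  assumes "\<alpha> > 0" "0 < c" "c \<le> C"
  shows "\<exists>\<kappa>>0. \<forall>s\<in>{c..C}. \<forall>t\<in>{c..C}. \<kappa> * (s - t)^2 \<le> (s - t) * (s powr \<alpha> - t powr \<alpha>)"
proof (intro exI conjI ballI)
  define \<mu> where "\<mu> = min (c powr (\<alpha> - 1)) (C powr (\<alpha> - 1))"
  show "\<alpha> * \<mu> > 0" using assms by (simp add: \<mu>_def)
  have \<mu>: "z powr (\<alpha> - 1) \<ge> \<mu>" if "z \<in> {c..C}" for z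
  proof (cases "\<alpha> \<ge> 1")
    case True
    then show ?thesis using that assms powr_mono2[of "\<alpha> - 1" c z] by (auto simp: \<mu>_def)
  next
    case False
    then show ?thesis using that assms powr_mono2'[of "\<alpha> - 1" z C] by (auto simp: \<mu>_def)
  qed
  have lt: "\<alpha> * \<mu> * (t - s) \<le> t powr \<alpha> - s powr \<alpha>" if "c \<le> s" "s < t" "t \<le> C" for s t
  proof -
    have "((\<lambda>z. z powr \<alpha>) has_real_derivative \<alpha> * z powr (\<alpha> - 1)) (at z)" if "s \<le> z" for z
      using that \<open>c \<le> s\<close> assms by (auto intro!: derivative_eq_intros simp: powr_diff)
    then obtain z where z: "s < z" "z < t" "t powr \<alpha> - s powr \<alpha> = (t - s) * (\<alpha> * z powr (\<alpha> - 1))"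
      using MVT2[OF \<open>s < t\<close>, of "\<lambda>z. z powr \<alpha>" "\<lambda>z. \<alpha> * z powr (\<alpha> - 1)"] by blast
    have "\<mu> * (\<alpha> * (t - s)) \<le> z powr (\<alpha> - 1) * (\<alpha> * (t - s))"
      using \<mu>[of z] z that assms by (intro mult_right_mono) auto
    then show ?thesis using z(3) by (simp add: algebra_simps)
  qed
  fix s t assume st: "s \<in> {c..C}" "t \<in> {c..C}"
  consider "s < t" | "s = t" | "t < s" by linarith
  then show "\<alpha> * \<mu> * (s - t)^2 \<le> (s - t) * (s powr \<alpha> - t powr \<alpha>)"
  proof cases
    case 1
    from mult_left_mono[OF lt[of s t], of "t - s"] 1 st
    show ?thesis by (simp add: algebra_simps power2_eq_square)
  next
    case 3
    from mult_left_mono[OF lt[of t s], of "s - t"] 3 st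
    show ?thesis by (simp add: algebra_simps power2_eq_square)
  qed simp
qed

text \<open>The right-hand side is twice the covariance of \<open>a\<close> and \<open>b\<close>
  under \<open>p\<close>. Writing it with two independent copies permits a comparison term by
  term.\<close>

lemma covariance_eq:
  fixes p a b :: "'a \<Rightarrow> real"
  assumes "finite A" "(\<Sum>v\<in>A. p v) = 1"
  shows "(\<Sum>v\<in>A. \<Sum>w\<in>A. p v * p w * ((a v - a w) * (b v - b w))) =
    2 * ((\<Sum>v\<in>A. p v * a v * b v) - (\<Sum>v\<in>A. p v * a v) * (\<Sum>v\<in>A. p v * b v))"
proof -
  have "p v * p w * ((a v - a w) * (b v - b w)) =
      (p v * a v * b v) * p w + p v * (p w * a w * b w) -
      ((p v * a v) * (p w * b w) + (p v * b v) * (p w * a w))" for v w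
    by (simp add: algebra_simps)
  then show ?thesis
    by (simp add: sum.distrib sum_subtractf sum_distrib_left[symmetric] sum_distrib_right[symmetric] assms)
qed

locale interaction_model =
  fixes m :: nat and V :: "nat \<Rightarrow> 'v set" and \<alpha> :: real
    and \<eta> :: "nat \<Rightarrow> 'v \<Rightarrow> real" and \<rho> :: "nat \<Rightarrow> nat \<Rightarrow> 'v \<Rightarrow> real"
  assumes V: "\<And>i. i \<in> {1..m} \<Longrightarrow> finite (V i) \<and> V i \<noteq> {}"
    and \<alpha>: "\<alpha> > 0"
    and \<rho>_sym: "\<And>v i j. i \<in> walks_at m V v \<Longrightarrow> j \<in> walks_at m V v \<Longrightarrow> \<rho> i j v = \<rho> j i v"
    and \<eta>_\<rho>: "\<And>v i. i \<in> walks_at m V v \<Longrightarrow>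
              \<eta> i v > (\<Sum>j | j \<in> walks_at m V v \<and> \<rho> i j v < 0. \<bar>\<rho> i j v\<bar>)"
begin

abbreviation "C \<equiv> coords m V"
abbreviation "D \<equiv> simplex_prod m V"
abbreviation "h \<equiv> affine_weight m V \<eta> \<rho>"
abbreviation "H \<equiv> weight m V \<alpha> \<eta> \<rho>"
abbreviation "\<pi> \<equiv> transition m V \<alpha> \<eta> \<rho>"
abbreviation "Fix \<equiv> fixed_points m V \<alpha> \<eta> \<rho>"

section \<open>Coordinates of the simplex product and bounds for the weights\<close>

lemma finite_C: "finite C"
  using V by (auto simp: coords_def)

lemma finite_walks_at: "finite (walks_at m V v)"
  by (simp add: walks_at_def)

lemma mem_C: "(i, v) \<in> C \<longleftrightarrow> i \<in> {1..m} \<and> v \<in> V i"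
  by (auto simp: coords_def)

lemma mem_walks_at: "i \<in> walks_at m V v \<longleftrightarrow> (i, v) \<in> C"
  by (auto simp: coords_def walks_at_def)

lemma simplex_prod_bounds:
  assumes "x \<in> D"
  shows "0 \<le> x i v" "x i v \<le> 1"
proof -
  have "0 \<le> x i v \<and> x i v \<le> 1"
  proof (cases "(i, v) \<in> C")
    case True
    then have i: "i \<in> {1..m}" "v \<in> V i" by (auto simp: mem_C)
    then have "x i v \<le> (\<Sum>v\<in>V i. x i v)"
      using assms V by (intro member_le_sum) (auto simp: simplex_prod_def)
    then show ?thesis using assms i by (auto simp: simplex_prod_def)
  next
    case False
    then show ?thesis using assms by (auto simp: simplex_prod_def coord_space_def)
  qed
  then show "0 \<le> x i v" "x i v \<le> 1" by auto
qed

lemma simplex_prod_sum: "x \<in> D \<Longrightarrow> i \<in> {1..m} \<Longrightarrow> (\<Sum>v\<in>V i. x i v) = 1"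
  by (auto simp: simplex_prod_def)

text \<open>Coordinates lie in [0, 1], so each interaction term is smallest at 0 or 1 according to
  the sign of its coefficient. This is where the condition relating \<eta> to the negative part of
  \<rho> originates.\<close>

lemma affine_weight_ge:
  assumes "x \<in> D"
  shows "h x i v \<ge> \<eta> i v - (\<Sum>j | j \<in> walks_at m V v \<and> \<rho> i j v < 0. \<bar>\<rho> i j v\<bar>)"
proof -
  let ?N = "{j. j \<in> walks_at m V v \<and> \<rho> i j v < 0}"
  have "- (\<Sum>j\<in>?N. \<bar>\<rho> i j v\<bar>) = (\<Sum>j\<in>?N. \<rho> i j v)"
    by (simp add: sum_negf[symmetric])
  also have "\<dots> = (\<Sum>j\<in>walks_at m V v. min (\<rho> i j v) 0)"
    using finite_walks_at by (intro sum.mono_neutral_cong_left) auto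
  also have "\<dots> \<le> (\<Sum>j\<in>walks_at m V v. \<rho> i j v * x j v)"
  proof (rule sum_mono)
    fix j
    have "x j v \<ge> 0" "x j v \<le> 1" using simplex_prod_bounds[OF assms] by auto
    then show "min (\<rho> i j v) 0 \<le> \<rho> i j v * x j v"
      using mult_left_mono_neg[of "x j v" 1 "\<rho> i j v"]
      by (cases "\<rho> i j v < 0") auto
  qed
  finally show ?thesis by (simp add: affine_weight_def)
qed

lemma affine_weight_le:
  assumes "x \<in> D"
  shows "h x i v \<le> \<bar>\<eta> i v\<bar> + (\<Sum>j\<in>walks_at m V v. \<bar>\<rho> i j v\<bar>)"
proof -
  have "\<rho> i j v * x j v \<le> \<bar>\<rho> i j v\<bar>" for j
    using simplex_prod_bounds[OF assms, of j v] mult_mono[of "\<rho> i j v" "\<bar>\<rho> i j v\<bar>" "x j v" 1] by auto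
  then show ?thesis unfolding affine_weight_def by (intro add_mono sum_mono) auto
qed

lemma affine_weight_pos:
  assumes "x \<in> D" "(i, v) \<in> C"
  shows "h x i v > 0"
  using affine_weight_ge[OF assms(1), of i v] \<eta>_\<rho>[of i v] assms(2) by (simp add: mem_walks_at)

lemma affine_weight_bounds:
  obtains c1 c2 where "0 < c1" "c1 \<le> c2" "\<And>x i v. x \<in> D \<Longrightarrow> (i, v) \<in> C \<Longrightarrow> h x i v \<in> {c1..c2}"
proof -
  define l where "l = (\<lambda>(i, v). \<eta> i v - (\<Sum>j | j \<in> walks_at m V v \<and> \<rho> i j v < 0. \<bar>\<rho> i j v\<bar>))"
  define u where "u = (\<lambda>(i, v). \<bar>\<eta> i v\<bar> + (\<Sum>j\<in>walks_at m V v. \<bar>\<rho> i j v\<bar>))"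
  \<comment> \<open>Inserting 1 keeps the minimum and the maximum meaningful even for empty
    \<open>C\<close>, and yields \<open>c1 \<le> 1 \<le> c2\<close> at once.\<close>
  define c1 where "c1 = Min (insert 1 (l ` C))"
  define c2 where "c2 = Max (insert 1 (u ` C))"
  have "l p > 0" if "p \<in> C" for p
    using \<eta>_\<rho>[of "fst p" "snd p"] that by (cases p) (auto simp: mem_walks_at l_def)
  then have "c1 > 0" using finite_C by (auto simp: c1_def)
  have "c1 \<le> 1" "1 \<le> c2" using finite_C by (auto simp: c1_def c2_def)
  have "h x i v \<in> {c1..c2}" if "x \<in> D" "(i, v) \<in> C" for x i v
  proof -
    have "c1 \<le> l (i, v)" unfolding c1_def using finite_C that by (intro Min_le) auto
    moreover have "u (i, v) \<le> c2" unfolding c2_def using finite_C that by (intro Max_ge) auto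
    ultimately show ?thesis
      using affine_weight_ge[OF that(1), of i v] affine_weight_le[OF that(1), of i v]
      by (auto simp: l_def u_def)
  qed
  with that[of c1 c2] \<open>c1 > 0\<close> \<open>c1 \<le> 1\<close> \<open>1 \<le> c2\<close> show thesis by simp
qed

lemma total_weight_pos:
  assumes "x \<in> D" "i \<in> {1..m}"
  shows "(\<Sum>w\<in>V i. x i w * H x i w) > 0"
proof -
  have nn: "x i w * H x i w \<ge> 0" for w
    using simplex_prod_bounds[OF assms(1), of i w] by (simp add: weight_def)
  obtain w where w: "w \<in> V i" "x i w \<noteq> 0"
    using simplex_prod_sum[OF assms] by (metis sum.neutral zero_neq_one)
  then have "x i w > 0" using simplex_prod_bounds[OF assms(1), of i w] by linarith
  then have "x i w * H x i w > 0"
    using affine_weight_pos[OF assms(1), of i w] w assms(2) by (simp add: weight_def mem_C)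
  then show ?thesis using nn w V[OF assms(2)] by (intro sum_pos2[of _ w]) auto
qed

subsection \<open>Fixed points\<close>

lemma finite_supports: "finite (supports m V)"
  using V by (auto simp: supports_def intro!: finite_PiE)

lemma positive_solutions_subset_D:
  assumes "S \<in> supports m V" "x \<in> positive_solutions m V \<eta> \<rho> S"
  shows "x \<in> D"
proof -
  have "(\<Sum>v\<in>V i. x i v) = 1 \<and> (\<forall>v\<in>V i. 0 \<le> x i v)" if i: "i \<in> {1..m}" for i
  proof -
    have S: "S i \<subseteq> V i" using assms(1) i by (auto simp: supports_def)
    have "(\<Sum>v\<in>V i. x i v) = (\<Sum>v\<in>S i. x i v)"
      using S V[OF i] assms(2) i by (intro sum.mono_neutral_right) (auto simp: positive_solutions_def)
    moreover have "0 \<le> x i v" if "v \<in> V i" for v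
      using assms(2) i that by (cases "v \<in> S i") (auto simp: positive_solutions_def less_imp_le)
    ultimately show ?thesis using assms(2) i by (auto simp: positive_solutions_def)
  qed
  then show ?thesis using assms(2) by (auto simp: simplex_prod_def positive_solutions_def)
qed

text \<open>Restricting the function to \<open>{1..m}\<close> makes it extensional, as membership in
  \<open>supports m V\<close> demands.\<close>

definition support :: "(nat \<Rightarrow> 'v \<Rightarrow> real) \<Rightarrow> nat \<Rightarrow> 'v set" where
  "support x = (\<lambda>i\<in>{1..m}. {v \<in> V i. x i v > 0})"

lemma support_in_supports: "support x \<in> supports m V"
  by (auto simp: support_def supports_def)

lemma positive_solutions_support:
  assumes x: "x \<in> D"
    and eq: "\<And>i v w. i \<in> {1..m} \<Longrightarrow> v \<in> support x i \<Longrightarrow> w \<in> support x i \<Longrightarrow> h x i v = h x i w"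
  shows "x \<in> positive_solutions m V \<eta> \<rho> (support x)"
  unfolding positive_solutions_def
proof (intro CollectI conjI ballI)
  show "x \<in> coord_space m V" using x by (auto simp: simplex_prod_def)
next
  fix i assume i: "i \<in> {1..m}"
  show "h x i v = h x i w" if "v \<in> support x i" "w \<in> support x i" for v w by (rule eq[OF i that])
  have "(\<Sum>v\<in>support x i. x i v) = (\<Sum>v\<in>V i. x i v)"
    using V[OF i] i simplex_prod_bounds[OF x]
    by (intro sum.mono_neutral_left) (auto simp: support_def less_le)
  then show "(\<Sum>v\<in>support x i. x i v) = 1" using simplex_prod_sum[OF x i] by simp
  show "x i u = 0" if "u \<in> V i - support x i" for u
    using that simplex_prod_bounds[OF x, of i u] i by (auto simp: support_def)
  show "x i v > 0" if "v \<in> support x i" for v using that i by (auto simp: support_def)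
qed

text \<open>Where a coordinate is positive, it cancels from the fixed-point equation and leaves
  \<open>H x i v\<close> equal to the mean weight, which is the same for all vertices of the walk;
  taking the root of order \<alpha> equates the affine weights. Conversely, equal weights on the
  support coincide with their mean, and vanishing coordinates are fixed in any case.\<close>

lemma fixed_points_eq: "Fix = (\<Union>S\<in>supports m V. positive_solutions m V \<eta> \<rho> S)"
proof (intro equalityI subsetI)
  fix x assume "x \<in> Fix"
  then have x: "x \<in> D" "\<pi> x = x" by (auto simp: fixed_points_def)
  have h_eq: "h x i v = (\<Sum>w\<in>V i. x i w * H x i w) powr (1 / \<alpha>)"
    if i: "i \<in> {1..m}" and "v \<in> support x i" for i v
  proof -
    let ?T = "\<Sum>w\<in>V i. x i w * H x i w"
    have v: "v \<in> V i" "x i v > 0" using that by (auto simp: support_def)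
    have "\<pi> x i v = x i v" using x by simp
    then have "H x i v = ?T"
      using v i total_weight_pos[OF x(1) i] by (simp add: transition_def mem_C field_simps)
    from this[symmetric] weight_def[of m V \<alpha> \<eta> \<rho> x i v]
    have "?T = h x i v powr \<alpha>" by (rule trans)
    then have "?T powr (1 / \<alpha>) = (h x i v powr \<alpha>) powr (1 / \<alpha>)" by (simp only:)
    also have "\<dots> = h x i v"
      using affine_weight_pos[OF x(1), of i v] v i \<alpha> by (simp add: powr_powr mem_C)
    finally show ?thesis by simp
  qed
  have "h x i v = h x i w" if "i \<in> {1..m}" "v \<in> support x i" "w \<in> support x i" for i v w
    using h_eq[OF that(1,2)] h_eq[OF that(1,3)] by simp
  then have "x \<in> positive_solutions m V \<eta> \<rho> (support x)"
    by (rule positive_solutions_support[OF x(1)])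
  then show "x \<in> (\<Union>S\<in>supports m V. positive_solutions m V \<eta> \<rho> S)"
    using support_in_supports by blast
next
  fix x assume "x \<in> (\<Union>S\<in>supports m V. positive_solutions m V \<eta> \<rho> S)"
  then obtain S where S: "S \<in> supports m V" "x \<in> positive_solutions m V \<eta> \<rho> S" by blast
  then have x: "x \<in> D" by (rule positive_solutions_subset_D)
  have "\<pi> x i v = x i v" for i v
  proof (cases "(i, v) \<in> C")
    case False
    then show ?thesis using x by (auto simp: transition_def simplex_prod_def coord_space_def)
  next
    case True
    then have i: "i \<in> {1..m}" "v \<in> V i" by (auto simp: mem_C)
    show ?thesis
    proof (cases "v \<in> S i")
      case False
      then have "x i v = 0" using S i by (auto simp: positive_solutions_def)
      then show ?thesis by (simp add: transition_def)
    next
      case v: True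
      have "x i w * H x i w = x i w * H x i v" if "w \<in> V i" for w
      proof (cases "w \<in> S i")
        case True
        then have "h x i w = h x i v" using S(2) i(1) v unfolding positive_solutions_def by blast
        then show ?thesis by (simp add: weight_def)
      next
        case False
        then have "x i w = 0" using S i that by (auto simp: positive_solutions_def)
        then show ?thesis by simp
      qed
      then have "(\<Sum>w\<in>V i. x i w * H x i w) = (\<Sum>w\<in>V i. x i w) * H x i v"
        unfolding sum_distrib_right by (rule sum.cong[OF refl])
      then have "(\<Sum>w\<in>V i. x i w * H x i w) = H x i v"
        using simplex_prod_sum[OF x i(1)] by simp
      moreover have "H x i v > 0"
        using affine_weight_pos[OF x True] by (simp add: weight_def)
      ultimately show ?thesis using True by (simp add: transition_def)
    qed
  qed
  then show "x \<in> Fix" using x by (auto simp: fixed_points_def)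
qed

section \<open>Connectedness of the solution sets\<close>

lemma affine_weight_convex:
  "h (\<lambda>i v. (1 - t) * x i v + t * y i v) i v = (1 - t) * h x i v + t * h y i v"
proof -
  let ?w = "walks_at m V v"
  have "(\<Sum>j\<in>?w. \<rho> i j v * ((1 - t) * x j v + t * y j v)) =
      (\<Sum>j\<in>?w. (1 - t) * (\<rho> i j v * x j v) + t * (\<rho> i j v * y j v))"
    by (intro sum.cong) (auto simp: algebra_simps)
  also have "\<dots> = (1 - t) * (\<Sum>j\<in>?w. \<rho> i j v * x j v) + t * (\<Sum>j\<in>?w. \<rho> i j v * y j v)"
    by (simp only: sum.distrib sum_distrib_left)
  finally show ?thesis by (simp add: affine_weight_def) (simp add: algebra_simps)
qed

text \<open>The set is convex: the equations are affine and positivity survives convex combinations,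
  so any two solutions are joined by a segment inside the set.\<close>

lemma connected_positive_solutions: "connected (positive_solutions m V \<eta> \<rho> S)" (is "connected ?P")
proof -
  have "connected_component ?P x y" if xy: "x \<in> ?P" "y \<in> ?P" for x y
  proof -
    let ?z = "\<lambda>t i v. (1 - t) * x i v + t * y i v :: real"
    have "continuous_on {0..1::real} ?z"
      by (intro continuous_on_coordinatewise_then_product continuous_intros)
    then have "connected (?z ` {0..1})" by (intro connected_continuous_image) auto
    moreover have "?z ` {0..1} \<subseteq> ?P"
    proof safe
      fix t :: real assume t: "t \<in> {0..1}"
      have pos: "?z t i v > 0" if "x i v > 0" "y i v > 0" for i v
      proof (cases "t = 0")
        case False
        then show ?thesis using t that by (intro add_nonneg_pos) auto
      qed (use that in simp)
      show "?z t \<in> ?P"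
        unfolding positive_solutions_def
      proof (intro CollectI conjI ballI)
        show "?z t \<in> coord_space m V"
          using xy by (simp add: positive_solutions_def coord_space_def)
      next
        fix i assume i: "i \<in> {1..m}"
        have "h x i v = h x i w" "h y i v = h y i w" if "v \<in> S i" "w \<in> S i" for v w
          using xy i that unfolding positive_solutions_def by blast+
        then show "h (?z t) i v = h (?z t) i w" if "v \<in> S i" "w \<in> S i" for v w
          using that unfolding affine_weight_convex by metis
        have "(\<Sum>v\<in>S i. ?z t i v) = (1 - t) * (\<Sum>v\<in>S i. x i v) + t * (\<Sum>v\<in>S i. y i v)"
          by (simp only: sum.distrib sum_distrib_left)
        then show "(\<Sum>v\<in>S i. ?z t i v) = 1"
          using xy i by (simp add: positive_solutions_def)
        show "?z t i u = 0" if "u \<in> V i - S i" for u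
          using xy i that by (simp add: positive_solutions_def)
        show "?z t i v > 0" if "v \<in> S i" for v
          using xy i that by (intro pos) (simp_all add: positive_solutions_def)
      qed
    qed
    moreover have "x \<in> ?z ` {0..1}" by (rule image_eqI[of _ _ 0]) auto
    moreover have "y \<in> ?z ` {0..1}" by (rule image_eqI[of _ _ 1]) auto
    ultimately show ?thesis unfolding connected_component_def by blast
  qed
  then show ?thesis by (simp add: connected_iff_connected_component)
qed

subsection \<open>The potential and its drift\<close>

text \<open>On \<open>D\<close> this is twice the sum, over the walks, of the variance of the affine
  weights under the probability vector \<open>x i\<close>.\<close>

definition spread :: "(nat \<Rightarrow> 'v \<Rightarrow> real) \<Rightarrow> real" where
  "spread x = (\<Sum>i\<in>{1..m}. \<Sum>v\<in>V i. \<Sum>w\<in>V i. x i v * x i w * (h x i v - h x i w)^2)"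

text \<open>By the symmetry of \<open>\<rho>\<close>, the partial derivatives of the potential are the affine weights.\<close>
definition potential :: "(nat \<Rightarrow> 'v \<Rightarrow> real) \<Rightarrow> real" where
  "potential x = (\<Sum>i\<in>{1..m}. \<Sum>v\<in>V i.
     \<eta> i v * x i v + (\<Sum>j\<in>walks_at m V v. \<rho> i j v * x i v * x j v) / 2)"

lemma spread_term_nonneg:
  assumes "x \<in> D"
  shows "0 \<le> x i v * x i w * (h x i v - h x i w)^2"
  by (intro mult_nonneg_nonneg simplex_prod_bounds(1)[OF assms] zero_le_power2)

lemma spread_nonneg: "x \<in> D \<Longrightarrow> spread x \<ge> 0"
  unfolding spread_def by (intro sum_nonneg spread_term_nonneg)

text \<open>All terms are nonnegative, so the sum vanishes only if the affine weights of a walk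
  agree on its support, and this is exactly the system solved by fixed points.\<close>

lemma fixed_points_iff_spread:
  assumes x: "x \<in> D"
  shows "x \<in> Fix \<longleftrightarrow> spread x = 0"
proof
  assume "x \<in> Fix"
  then obtain S where S: "S \<in> supports m V" "x \<in> positive_solutions m V \<eta> \<rho> S"
    using fixed_points_eq by blast
  have "x i v * x i w * (h x i v - h x i w)^2 = 0" if i: "i \<in> {1..m}" "v \<in> V i" "w \<in> V i" for i v w
  proof (cases "v \<in> S i \<and> w \<in> S i")
    case True
    then have "h x i v = h x i w" using S(2) i(1) unfolding positive_solutions_def by blast
    then show ?thesis by simp
  next
    case False
    then have "x i v = 0 \<or> x i w = 0" using S(2) i unfolding positive_solutions_def by blast
    then show ?thesis by auto
  qed
  then show "spread x = 0" unfolding spread_def by (intro sum.neutral ballI)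
next
  assume 0: "spread x = 0"
  note nn = spread_term_nonneg[OF x]
  have zero: "x i v * x i w * (h x i v - h x i w)^2 = 0" if i: "i \<in> {1..m}" "v \<in> V i" "w \<in> V i" for i v w
  proof -
    have "(\<Sum>v\<in>V i. \<Sum>w\<in>V i. x i v * x i w * (h x i v - h x i w)^2) = 0"
      using 0 nn i unfolding spread_def by (subst (asm) sum_nonneg_eq_0_iff) (auto intro!: sum_nonneg)
    then have "(\<Sum>w\<in>V i. x i v * x i w * (h x i v - h x i w)^2) = 0"
      using nn i V[OF i(1)] by (subst (asm) sum_nonneg_eq_0_iff) (auto intro!: sum_nonneg)
    then show ?thesis
      using nn i V[OF i(1)] by (subst (asm) sum_nonneg_eq_0_iff) auto
  qed
  have "h x i v = h x i w" if "i \<in> {1..m}" "v \<in> support x i" "w \<in> support x i" for i v w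
  proof -
    have "v \<in> V i" "w \<in> V i" "x i v > 0" "x i w > 0" using that by (auto simp: support_def)
    then show ?thesis using zero[OF that(1), of v w] by simp
  qed
  then have "x \<in> positive_solutions m V \<eta> \<rho> (support x)"
    by (rule positive_solutions_support[OF x])
  then show "x \<in> Fix" using support_in_supports fixed_points_eq by blast
qed

text \<open>The drift of the potential is a sum of covariances of the affine weights with an increasing
  function of them.\<close>
lemma drift_ge_spread:
  obtains \<kappa> where "\<kappa> > 0"
    "\<And>x i. x \<in> D \<Longrightarrow> i \<in> {1..m} \<Longrightarrow>
       \<kappa> * (\<Sum>v\<in>V i. \<Sum>w\<in>V i. x i v * x i w * (h x i v - h x i w)^2) \<le>
       (\<Sum>v\<in>V i. h x i v * (\<pi> x i v - x i v))"
proof -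
  obtain c1 c2 where c: "0 < c1" "c1 \<le> c2" "\<And>x i v. x \<in> D \<Longrightarrow> (i, v) \<in> C \<Longrightarrow> h x i v \<in> {c1..c2}"
    using affine_weight_bounds by blast
  obtain \<kappa> where \<kappa>: "\<kappa> > 0"
    "\<And>s t. s \<in> {c1..c2} \<Longrightarrow> t \<in> {c1..c2} \<Longrightarrow> \<kappa> * (s - t)^2 \<le> (s - t) * (s powr \<alpha> - t powr \<alpha>)"
    using powr_diff_mult_diff_ge[OF \<alpha> c(1,2)] by blast
  \<comment> \<open>\<open>B\<close> bounds the normalising sum \<open>T\<close>, a convex
    combination of the weights; dividing by \<open>B\<close> makes the constant independent of the
    point.\<close>
  define B where "B = c2 powr \<alpha>"
  have "B > 0" using c by (simp add: B_def)
  show thesis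
  proof (rule that[of "\<kappa> / (2 * B)"])
    show "\<kappa> / (2 * B) > 0" using \<kappa> \<open>B > 0\<close> by simp
    fix x i assume x: "x \<in> D" and i: "i \<in> {1..m}"
    define T where "T = (\<Sum>w\<in>V i. x i w * H x i w)"
    have "T > 0" unfolding T_def by (rule total_weight_pos[OF x i])
    have hc: "h x i v \<in> {c1..c2}" if "v \<in> V i" for v
      using c(3)[OF x, of i v] that i by (simp add: mem_C)
    have "T \<le> (\<Sum>w\<in>V i. x i w * B)"
      unfolding T_def B_def weight_def
    proof (intro sum_mono mult_left_mono powr_mono2 simplex_prod_bounds(1)[OF x])
      fix w assume "w \<in> V i"
      from hc[OF this] c(1) show "0 \<le> h x i w" "h x i w \<le> c2" by auto
    qed (use \<alpha> in simp)
    then have "T \<le> B" using simplex_prod_sum[OF x i] by (simp add: sum_distrib_right[symmetric])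
    define Q where "Q = (\<Sum>v\<in>V i. \<Sum>w\<in>V i. x i v * x i w * (h x i v - h x i w)^2)"
    define R where "R = (\<Sum>v\<in>V i. \<Sum>w\<in>V i. x i v * x i w * ((h x i v - h x i w) * (H x i v - H x i w)))"
    have "\<kappa> * Q = (\<Sum>v\<in>V i. \<Sum>w\<in>V i. x i v * x i w * (\<kappa> * (h x i v - h x i w)^2))"
      by (simp add: Q_def sum_distrib_left mult.left_commute)
    also have "\<dots> \<le> R"
      unfolding R_def weight_def
      by (intro sum_mono mult_left_mono \<kappa>(2) hc mult_nonneg_nonneg simplex_prod_bounds(1)[OF x])
    finally have QR: "\<kappa> * Q \<le> R" .
    have "Q \<ge> 0"
      unfolding Q_def by (intro sum_nonneg spread_term_nonneg[OF x])
    have "(\<Sum>v\<in>V i. h x i v * (\<pi> x i v - x i v)) =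
        (\<Sum>v\<in>V i. (x i v * h x i v * H x i v) / T - x i v * h x i v)"
      using i by (intro sum.cong refl) (simp add: transition_def mem_C T_def[symmetric] right_diff_distrib mult_ac)
    also have "\<dots> = (\<Sum>v\<in>V i. x i v * h x i v * H x i v) / T - (\<Sum>v\<in>V i. x i v * h x i v)"
      by (simp add: sum_subtractf sum_divide_distrib)
    \<comment> \<open>\<open>T\<close> is the mean of \<open>H\<close>, so factoring out 1 /
      \<open>T\<close> leaves the mean of the product of \<open>h\<close> and \<open>H\<close> minus
      the product of their means.\<close>
    also have "\<dots> = R / (2 * T)"
      using covariance_eq[of "V i" "x i" "h x i" "H x i"] V[OF i] simplex_prod_sum[OF x i] \<open>T > 0\<close>
      by (simp add: R_def T_def[symmetric] diff_divide_distrib)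
    finally have eq: "(\<Sum>v\<in>V i. h x i v * (\<pi> x i v - x i v)) = R / (2 * T)" .
    have "\<kappa> / (2 * B) * Q = \<kappa> * Q / (2 * B)" by simp
    also have "\<dots> \<le> \<kappa> * Q / (2 * T)"
      using \<open>T \<le> B\<close> \<open>T > 0\<close> \<open>Q \<ge> 0\<close> \<kappa> \<open>B > 0\<close> by (intro divide_left_mono) auto
    also have "\<dots> \<le> R / (2 * T)"
      using QR \<open>T > 0\<close> by (intro divide_right_mono) auto
    finally show "\<kappa> / (2 * B) * Q \<le> (\<Sum>v\<in>V i. h x i v * (\<pi> x i v - x i v))" using eq by simp
  qed
qed

text \<open>Regrouped by vertices, the sum runs over all ordered pairs of walks at a vertex, a
  domain symmetric in the two walks.\<close>

lemma sum_walks_swap: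
  "(\<Sum>i\<in>{1..m}. \<Sum>v\<in>V i. \<Sum>j\<in>walks_at m V v. g i j v) =
   (\<Sum>i\<in>{1..m}. \<Sum>v\<in>V i. \<Sum>j\<in>walks_at m V v. g j i v :: real)"
proof -
  let ?U = "\<Union>i\<in>{1..m}. V i"
  have U: "finite ?U" using V by auto
  have *: "(\<Sum>i\<in>{1..m}. \<Sum>v\<in>V i. f i v) = (\<Sum>v\<in>?U. \<Sum>i\<in>walks_at m V v. f i v)"
    for f :: "nat \<Rightarrow> 'v \<Rightarrow> real"
  proof -
    have "(\<Sum>i\<in>{1..m}. \<Sum>v\<in>V i. f i v) = (\<Sum>i\<in>{1..m}. \<Sum>v | v \<in> ?U \<and> v \<in> V i. f i v)"
      by (intro sum.cong) auto
    also have "\<dots> = (\<Sum>v\<in>?U. \<Sum>i | i \<in> {1..m} \<and> v \<in> V i. f i v)"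
      using U by (intro sum.swap_restrict) auto
    finally show ?thesis by (simp add: walks_at_def)
  qed
  show ?thesis unfolding * by (intro sum.cong refl sum.swap)
qed

text \<open>The potential is quadratic, so its second-order expansion is exact. The two mixed terms
  coincide by the symmetry of \<rho> and complete the gradient \<open>h\<close>; the remainder is
  half the quadratic form of \<rho> in the increments, whence the constant \<open>R\<close>.\<close>

lemma potential_increment_ge:
  obtains R where "R \<ge> 0"
    "\<And>x y \<delta>. (\<And>i v. \<bar>y i v - x i v\<bar> \<le> \<delta>) \<Longrightarrow>
       potential y - potential x \<ge>
         (\<Sum>i\<in>{1..m}. \<Sum>v\<in>V i. h x i v * (y i v - x i v)) - R * \<delta>^2"
proof
  define R where "R = (\<Sum>i\<in>{1..m}. \<Sum>v\<in>V i. \<Sum>j\<in>walks_at m V v. \<bar>\<rho> i j v\<bar> / 2)"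
  show "R \<ge> 0" unfolding R_def by (intro sum_nonneg) auto
  fix x y :: "nat \<Rightarrow> 'v \<Rightarrow> real" and \<delta> :: real
  assume \<delta>: "\<And>i v. \<bar>y i v - x i v\<bar> \<le> \<delta>"
  define d where "d = (\<lambda>i v. y i v - x i v)"
  have y: "y i v = x i v + d i v" for i v by (simp add: d_def)
  let ?S = "\<lambda>g. \<Sum>i\<in>{1..m}. \<Sum>v\<in>V i. \<Sum>j\<in>walks_at m V v. (g i j v :: real)"
  have "\<delta> \<ge> 0" using \<delta>[of 0 undefined] by linarith
  have "potential y - potential x =
     (\<Sum>i\<in>{1..m}. \<Sum>v\<in>V i. \<eta> i v * d i v +
        (\<Sum>j\<in>walks_at m V v. \<rho> i j v * d i v * x j v / 2 + \<rho> i j v * d j v * x i v / 2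
          + \<rho> i j v * d i v * d j v / 2))"
    unfolding potential_def sum_subtractf[symmetric] sum_divide_distrib add_diff_add
    by (intro sum.cong refl arg_cong2[of _ _ _ _ "(+)"]) (simp_all add: y algebra_simps add_divide_distrib)
  also have "\<dots> = (\<Sum>i\<in>{1..m}. \<Sum>v\<in>V i. \<eta> i v * d i v) + ?S (\<lambda>i j v. \<rho> i j v * d i v * x j v / 2) +
      ?S (\<lambda>i j v. \<rho> i j v * d j v * x i v / 2) + ?S (\<lambda>i j v. \<rho> i j v * d i v * d j v / 2)"
    by (simp add: sum.distrib)
  also have "?S (\<lambda>i j v. \<rho> i j v * d j v * x i v / 2) = ?S (\<lambda>i j v. \<rho> j i v * d i v * x j v / 2)"
    by (rule sum_walks_swap)
  also have "\<dots> = ?S (\<lambda>i j v. \<rho> i j v * d i v * x j v / 2)"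
  proof (intro sum.cong refl)
    fix i v j assume "i \<in> {1..m}" "v \<in> V i" "j \<in> walks_at m V v"
    then have "\<rho> j i v = \<rho> i j v" by (intro \<rho>_sym) (auto simp: walks_at_def)
    then show "\<rho> j i v * d i v * x j v / 2 = \<rho> i j v * d i v * x j v / 2" by simp
  qed
  also have "(\<Sum>i\<in>{1..m}. \<Sum>v\<in>V i. \<eta> i v * d i v) + ?S (\<lambda>i j v. \<rho> i j v * d i v * x j v / 2) +
      ?S (\<lambda>i j v. \<rho> i j v * d i v * x j v / 2) =
      (\<Sum>i\<in>{1..m}. \<Sum>v\<in>V i. h x i v * d i v)"
    unfolding sum.distrib[symmetric] affine_weight_def distrib_right sum_distrib_right add.assoc
    by (intro sum.cong refl arg_cong2[of _ _ _ _ "(+)"]) (simp add: algebra_simps)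
  finally have eq: "potential y - potential x = (\<Sum>i\<in>{1..m}. \<Sum>v\<in>V i. h x i v * d i v) +
      ?S (\<lambda>i j v. \<rho> i j v * d i v * d j v / 2)" .
  have "- (R * \<delta>^2) = ?S (\<lambda>i j v. - (\<bar>\<rho> i j v\<bar> / 2 * \<delta>^2))"
    by (simp only: R_def sum_distrib_right sum_negf)
  also have "\<dots> \<le> ?S (\<lambda>i j v. \<rho> i j v * d i v * d j v / 2)"
  proof (intro sum_mono)
    fix i v j
    have "\<bar>d i v\<bar> * \<bar>d j v\<bar> \<le> \<delta> * \<delta>"
      using \<delta> \<open>\<delta> \<ge> 0\<close> by (intro mult_mono) (auto simp: d_def)
    then have "\<bar>\<rho> i j v\<bar> * (\<bar>d i v\<bar> * \<bar>d j v\<bar>) \<le> \<bar>\<rho> i j v\<bar> * (\<delta> * \<delta>)"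
      by (intro mult_left_mono) auto
    then have "\<bar>\<rho> i j v * d i v * d j v\<bar> \<le> \<bar>\<rho> i j v\<bar> * \<delta>^2"
      by (simp add: abs_mult power2_eq_square mult.assoc)
    then show "- (\<bar>\<rho> i j v\<bar> / 2 * \<delta>^2) \<le> \<rho> i j v * d i v * d j v / 2" by (simp add: abs_le_iff)
  qed
  finally show "potential y - potential x \<ge>
         (\<Sum>i\<in>{1..m}. \<Sum>v\<in>V i. h x i v * (y i v - x i v)) - R * \<delta>^2"
    unfolding eq by (simp add: d_def)
qed

subsection \<open>Lipschitz estimates\<close>

text \<open>Boundedness accompanies the Lipschitz condition so that the class is closed under
  products. The number \<delta> stands for any bound on the supremum distance of the two
  points.\<close>

definition bounded_lipschitz :: "((nat \<Rightarrow> 'v \<Rightarrow> real) \<Rightarrow> real) \<Rightarrow> bool" where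
  "bounded_lipschitz f \<longleftrightarrow> (\<exists>K. \<forall>x\<in>D. \<bar>f x\<bar> \<le> K \<and>
     (\<forall>y\<in>D. \<forall>\<delta>. (\<forall>i v. \<bar>x i v - y i v\<bar> \<le> \<delta>) \<longrightarrow> \<bar>f x - f y\<bar> \<le> K * \<delta>))"

lemma bounded_lipschitz_const: "bounded_lipschitz (\<lambda>x. c)"
  unfolding bounded_lipschitz_def
proof (intro exI[of _ "\<bar>c\<bar>"] ballI conjI allI impI)
  fix x y :: "nat \<Rightarrow> 'v \<Rightarrow> real" and \<delta> assume "\<forall>i v. \<bar>x i v - y i v\<bar> \<le> \<delta>"
  then have "\<delta> \<ge> 0" by (meson abs_ge_zero order_trans)
  then show "\<bar>c - c\<bar> \<le> \<bar>c\<bar> * \<delta>" by simp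
qed simp

lemma bounded_lipschitz_coord: "bounded_lipschitz (\<lambda>x. x i v)"
  unfolding bounded_lipschitz_def
proof (intro exI[of _ 1] ballI conjI allI impI)
  fix x assume "x \<in> D"
  from simplex_prod_bounds[OF this, of i v] show "\<bar>x i v\<bar> \<le> 1" by simp
qed simp

lemma bounded_lipschitz_add:
  assumes "bounded_lipschitz f" "bounded_lipschitz g"
  shows "bounded_lipschitz (\<lambda>x. f x + g x)"
proof -
  obtain K where K: "\<And>x. x \<in> D \<Longrightarrow> \<bar>f x\<bar> \<le> K"
    "\<And>x y \<delta>. x \<in> D \<Longrightarrow> y \<in> D \<Longrightarrow> (\<And>i v. \<bar>x i v - y i v\<bar> \<le> \<delta>) \<Longrightarrow> \<bar>f x - f y\<bar> \<le> K * \<delta>"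
    using assms(1) unfolding bounded_lipschitz_def by blast
  obtain L where L: "\<And>x. x \<in> D \<Longrightarrow> \<bar>g x\<bar> \<le> L"
    "\<And>x y \<delta>. x \<in> D \<Longrightarrow> y \<in> D \<Longrightarrow> (\<And>i v. \<bar>x i v - y i v\<bar> \<le> \<delta>) \<Longrightarrow> \<bar>g x - g y\<bar> \<le> L * \<delta>"
    using assms(2) unfolding bounded_lipschitz_def by blast
  show ?thesis
    unfolding bounded_lipschitz_def
  proof (intro exI[of _ "K + L"] ballI conjI allI impI)
    fix x assume x: "x \<in> D"
    show "\<bar>f x + g x\<bar> \<le> K + L" using K(1)[OF x] L(1)[OF x] by linarith
    fix y \<delta> assume "y \<in> D" "\<forall>i v. \<bar>x i v - y i v\<bar> \<le> \<delta>"
    then have "\<bar>f x - f y\<bar> \<le> K * \<delta>" "\<bar>g x - g y\<bar> \<le> L * \<delta>" using K(2) L(2) x by auto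
    then show "\<bar>f x + g x - (f y + g y)\<bar> \<le> (K + L) * \<delta>" by (simp add: distrib_right abs_le_iff)
  qed
qed

lemma bounded_lipschitz_mult:
  assumes "bounded_lipschitz f" "bounded_lipschitz g"
  shows "bounded_lipschitz (\<lambda>x. f x * g x)"
proof -
  obtain K where K: "\<And>x. x \<in> D \<Longrightarrow> \<bar>f x\<bar> \<le> K"
    "\<And>x y \<delta>. x \<in> D \<Longrightarrow> y \<in> D \<Longrightarrow> (\<And>i v. \<bar>x i v - y i v\<bar> \<le> \<delta>) \<Longrightarrow> \<bar>f x - f y\<bar> \<le> K * \<delta>"
    using assms(1) unfolding bounded_lipschitz_def by blast
  obtain L where L: "\<And>x. x \<in> D \<Longrightarrow> \<bar>g x\<bar> \<le> L"
    "\<And>x y \<delta>. x \<in> D \<Longrightarrow> y \<in> D \<Longrightarrow> (\<And>i v. \<bar>x i v - y i v\<bar> \<le> \<delta>) \<Longrightarrow> \<bar>g x - g y\<bar> \<le> L * \<delta>"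
    using assms(2) unfolding bounded_lipschitz_def by blast
  show ?thesis
    unfolding bounded_lipschitz_def
  \<comment> \<open>The product rule contributes \<open>K * L\<close> once for each factor; the
    bound on the values is covered as well.\<close>
  proof (intro exI[of _ "K * L + K * L"] ballI conjI allI impI)
    fix x assume x: "x \<in> D"
    have KL: "K \<ge> 0" "L \<ge> 0" using K(1)[OF x] L(1)[OF x] by linarith+
    then have "\<bar>f x\<bar> * \<bar>g x\<bar> \<le> K * L" "0 \<le> K * L"
      using K(1)[OF x] L(1)[OF x] by (auto intro!: mult_mono)
    then show "\<bar>f x * g x\<bar> \<le> K * L + K * L" unfolding abs_mult by linarith
    fix y \<delta> assume y: "y \<in> D" and \<delta>: "\<forall>i v. \<bar>x i v - y i v\<bar> \<le> \<delta>"
    have fg: "\<bar>f x - f y\<bar> \<le> K * \<delta>" "\<bar>g x - g y\<bar> \<le> L * \<delta>" using K(2) L(2) x y \<delta> by auto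
    have "f x * g x - f y * g y = f x * (g x - g y) + (f x - f y) * g y" by (simp add: algebra_simps)
    then have "\<bar>f x * g x - f y * g y\<bar> \<le> \<bar>f x\<bar> * \<bar>g x - g y\<bar> + \<bar>f x - f y\<bar> * \<bar>g y\<bar>"
      by (metis abs_mult abs_triangle_ineq)
    also have "\<dots> \<le> K * (L * \<delta>) + (K * \<delta>) * L"
      using K(1)[OF x] L(1)[OF y] fg KL by (intro add_mono mult_mono) auto
    finally show "\<bar>f x * g x - f y * g y\<bar> \<le> (K * L + K * L) * \<delta>" by (simp add: algebra_simps)
  qed
qed

lemma bounded_lipschitz_sum:
  assumes "\<And>a. a \<in> A \<Longrightarrow> bounded_lipschitz (f a)"
  shows "bounded_lipschitz (\<lambda>x. \<Sum>a\<in>A. f a x)"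
  using assms
proof (induction A rule: infinite_finite_induct)
  case (insert a A)
  then have "bounded_lipschitz (\<lambda>x. f a x + (\<Sum>a\<in>A. f a x))"
    by (intro bounded_lipschitz_add) simp_all
  then show ?case using insert.hyps by simp
qed (simp_all add: bounded_lipschitz_const)

lemma bounded_lipschitz_affine_weight: "bounded_lipschitz (\<lambda>x. h x i v)"
  unfolding affine_weight_def
  by (intro bounded_lipschitz_add bounded_lipschitz_const bounded_lipschitz_sum
      bounded_lipschitz_mult bounded_lipschitz_coord)

lemma bounded_lipschitz_spread: "bounded_lipschitz spread"
proof -
  \<comment> \<open>Subtraction and squaring are expanded into sums and products, so that the
    closure rules apply.\<close>
  have eq: "spread = (\<lambda>x. \<Sum>i\<in>{1..m}. \<Sum>v\<in>V i. \<Sum>w\<in>V i. x i v * x i w *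
      ((h x i v + (- 1) * h x i w) * (h x i v + (- 1) * h x i w)))"
    by (simp add: spread_def fun_eq_iff power2_eq_square)
  show ?thesis
    unfolding eq
    by (intro bounded_lipschitz_add bounded_lipschitz_const bounded_lipschitz_sum
        bounded_lipschitz_mult bounded_lipschitz_coord bounded_lipschitz_affine_weight)
qed

lemma bounded_lipschitz_potential: "bounded_lipschitz potential"
  unfolding potential_def[abs_def] divide_inverse
  by (intro bounded_lipschitz_add bounded_lipschitz_const bounded_lipschitz_sum
      bounded_lipschitz_mult bounded_lipschitz_coord)

subsection \<open>Metrizing the coordinate space\<close>

text \<open>Functions on an arbitrary vertex type carry no metric; listing the finitely many coordinates
  embeds the coordinate space as a closed set into the metric space of real sequences.\<close>

definition encode :: "(nat \<Rightarrow> 'v \<Rightarrow> real) \<Rightarrow> nat \<Rightarrow> real" where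
  "encode x k = (if k < card C then x (fst (from_nat_into C k)) (snd (from_nat_into C k)) else 0)"

definition decode :: "(nat \<Rightarrow> real) \<Rightarrow> nat \<Rightarrow> 'v \<Rightarrow> real" where
  "decode z i v = (if (i, v) \<in> C then z (to_nat_on C (i, v)) else 0)"

lemma decode_encode:
  assumes "x \<in> coord_space m V"
  shows "decode (encode x) = x"
proof (intro ext)
  fix i v
  show "decode (encode x) i v = x i v"
  proof (cases "(i, v) \<in> C")
    case True
    then have "to_nat_on C (i, v) < card C"
      using to_nat_on_finite[OF finite_C] by (auto simp: bij_betw_def)
    then show ?thesis
      using True finite_C by (simp add: encode_def decode_def countable_finite)
  qed (use assms in \<open>auto simp: decode_def coord_space_def\<close>)
qed

lemma encode_decode:
  assumes "\<And>k. k \<ge> card C \<Longrightarrow> z k = 0"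
  shows "encode (decode z) = z"
proof
  fix k
  show "encode (decode z) k = z k"
  proof (cases "k < card C")
    case True
    then have "from_nat_into C k \<in> C"
      using bij_betw_from_nat_into_finite[OF finite_C] by (auto simp: bij_betw_def)
    moreover have "k \<in> to_nat_on C ` C"
      using True to_nat_on_finite[OF finite_C] by (simp add: bij_betw_def)
    then have "to_nat_on C (from_nat_into C k) = k" by (rule to_nat_on_from_nat_into)
    ultimately
    show ?thesis using True by (cases "from_nat_into C k") (auto simp: encode_def decode_def)
  qed (use assms in \<open>auto simp: encode_def\<close>)
qed

lemma continuous_on_coord: "continuous_on A (\<lambda>x :: nat \<Rightarrow> 'v \<Rightarrow> real. x i v)"
  by (rule continuous_on_subset[OF continuous_on_compose2[OF continuous_on_product_coordinates
        [of v] continuous_on_product_coordinates[of i] subset_UNIV] subset_UNIV])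

lemma continuous_on_seq: "continuous_on A (\<lambda>z :: nat \<Rightarrow> real. z k)"
  by (rule continuous_on_subset[OF continuous_on_product_coordinates subset_UNIV])

lemma continuous_on_encode: "continuous_on A encode"
proof (intro continuous_on_coordinatewise_then_product)
  fix k show "continuous_on A (\<lambda>x. encode x k)"
    unfolding encode_def by (cases "k < card C") (auto intro: continuous_on_coord)
qed

lemma continuous_on_decode: "continuous_on A decode"
proof (intro continuous_on_coordinatewise_then_product)
  fix i v show "continuous_on A (\<lambda>z. decode z i v)"
    unfolding decode_def by (cases "(i, v) \<in> C") (auto intro: continuous_on_seq)
qed

lemma continuous_on_spread: "continuous_on A spread"
  unfolding spread_def[abs_def] affine_weight_def
  by (intro continuous_intros continuous_on_coord)

lemma closed_coord_space: "closed (coord_space m V)"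
proof -
  have "coord_space m V = (\<Inter>(i, v)\<in>- C. {x. x i v = 0})"
    by (auto simp: coord_space_def)
  also have "closed \<dots>"
    by (auto intro!: closed_INT closed_Collect_eq continuous_on_coord)
  finally show ?thesis .
qed

lemma closed_simplex_prod: "closed D"
proof -
  have "D = coord_space m V \<inter>
     (\<Inter>i\<in>{1..m}. (\<Inter>v\<in>V i. {x. 0 \<le> x i v}) \<inter> {x. (\<Sum>v\<in>V i. x i v) = 1})"
    by (auto simp: simplex_prod_def)
  also have "closed \<dots>"
    by (intro closed_Int closed_coord_space closed_INT ballI closed_Collect_eq closed_Collect_le
        continuous_intros continuous_on_coord)
  finally show ?thesis .
qed

text \<open>The range of \<open>encode\<close>: sequences that vanish beyond the number of
  coordinates. On it, \<open>decode\<close> is injective.\<close>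

definition encoded_space :: "(nat \<Rightarrow> real) set" where
  "encoded_space = (\<Inter>k\<in>{card C..}. {z. z k = 0})"

lemma closed_encoded_space: "closed encoded_space"
  unfolding encoded_space_def
  by (intro closed_INT ballI closed_Collect_eq continuous_intros continuous_on_seq)

lemma encode_in_encoded_space: "encode x \<in> encoded_space"
  by (auto simp: encoded_space_def encode_def)

lemma encode_decode_encoded_space: "z \<in> encoded_space \<Longrightarrow> encode (decode z) = z"
  by (intro encode_decode) (auto simp: encoded_space_def)

text \<open>\<open>decode\<close> is a closed map on \<open>encoded_space\<close>, because the image
  of a closed subset is its preimage under the continuous \<open>encode\<close>, cut down to the
  closed coordinate space.\<close>

lemma limit_set_decode:
  assumes "\<And>n. x n \<in> coord_space m V"
  shows "limit_set x = decode ` limit_set (\<lambda>n. encode (x n))"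
proof -
  have "limit_set (\<lambda>n. decode (encode (x n))) = decode ` limit_set (\<lambda>n. encode (x n))"
  proof (rule limit_set_image[OF closed_encoded_space encode_in_encoded_space])
    show "inj_on decode encoded_space"
      by (rule inj_on_inverseI[of _ encode]) (rule encode_decode_encoded_space)
    show "closed (decode ` A)" if A: "closed A" "A \<subseteq> encoded_space" for A
    proof -
      have "decode ` A = coord_space m V \<inter> encode -` A"
      proof (intro equalityI subsetI)
        fix y assume "y \<in> decode ` A"
        then obtain z where z: "z \<in> A" "y = decode z" by auto
        then have "encode y = z" using encode_decode_encoded_space A by auto
        then show "y \<in> coord_space m V \<inter> encode -` A"
          using z by (auto simp: coord_space_def decode_def)
      next
        fix y assume "y \<in> coord_space m V \<inter> encode -` A"
        then have "y = decode (encode y)" "encode y \<in> A" using decode_encode[of y] by auto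
        then show "y \<in> decode ` A" by (rule image_eqI)
      qed
      then show ?thesis
        using closed_vimage[OF A(1) continuous_on_encode] closed_coord_space by (metis closed_Int)
    qed
  qed (rule continuous_on_decode)
  then show ?thesis using assms by (simp add: decode_encode)
qed

lemma limit_set_encode:
  assumes "\<And>n. x n \<in> coord_space m V"
  shows "limit_set (\<lambda>n. encode (x n)) = encode ` limit_set x"
proof -
  have "limit_set (\<lambda>n. encode (x n)) \<subseteq> encoded_space"
    by (rule limit_set_subset[OF closed_encoded_space encode_in_encoded_space])
  then show ?thesis
    using encode_decode_encoded_space unfolding limit_set_decode[OF assms] image_image
    by (simp add: subset_iff)
qed

subsection \<open>Slowly varying trajectories\<close>

context
  fixes x :: "nat \<Rightarrow> nat \<Rightarrow> 'v \<Rightarrow> real"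
  assumes xD: "\<And>n. x n \<in> D"
begin

lemma x_coord_space: "x n \<in> coord_space m V"
  using xD by (auto simp: simplex_prod_def)

lemma limit_set_x: "limit_set x = decode ` limit_set (\<lambda>n. encode (x n))"
  using x_coord_space by (rule limit_set_decode)

text \<open>By Tychonoff's theorem; this cube contains the encodings of all points of
  \<open>D\<close>.\<close>

lemma compact_unit_sequences: "compact (Pi\<^sub>E UNIV (\<lambda>_::nat. {0..1::real}))"
  using compactin_PiE[of "\<lambda>_::nat. euclidean :: real topology" UNIV "\<lambda>_. {0..1}"]
  by (simp add: euclidean_product_topology)

lemma encode_in_unit_sequences: "encode (x n) \<in> Pi\<^sub>E UNIV (\<lambda>_::nat. {0..1::real})"
  using simplex_prod_bounds[OF xD] by (simp add: encode_def PiE_iff)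

lemma trajectory_limit_set_nonempty: "limit_set x \<noteq> {}"
  unfolding limit_set_x
  using limit_set_nonempty[OF compact_unit_sequences encode_in_unit_sequences] by simp

context
  assumes slow: "\<And>n i v. \<bar>x (Suc n) i v - x n i v\<bar> \<le> 1 / real (Suc n)"
begin

text \<open>The metric on sequences weights the truncated coordinate distances by powers of 1 / 2,
  of total mass 2. Coordinate steps of at most \<open>1 / real (Suc n)\<close> therefore give steps
  of at most twice that size.\<close>

lemma connected_limit_set_encode: "connected (limit_set (\<lambda>n. encode (x n)))"
proof (rule connected_limit_set[OF compact_unit_sequences encode_in_unit_sequences])
    have dist_le: "dist (encode (x (Suc n))) (encode (x n)) \<le> 2 * (1 / real (Suc n))" for n
    proof -
      have "dist (encode (x (Suc n)) k) (encode (x n) k) \<le> 1 / real (Suc n)" for k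
        using slow by (simp add: encode_def dist_real_def)
      then have le: "min (dist (encode (x (Suc n)) k) (encode (x n) k)) 1 \<le> 1 / real (Suc n)" for k
        by (meson min.coboundedI1)
      have geo: "(\<lambda>k. (1 / 2 :: real) ^ k) sums 2" using geometric_sums[of "1/2 :: real"] by simp
      then have geo': "(\<lambda>k. (1 / 2) ^ k * (1 / real (Suc n))) sums (2 * (1 / real (Suc n)))"
        by (rule sums_mult2)
      have "dist (encode (x (Suc n))) (encode (x n)) =
          (\<Sum>k. (1/2)^k * min (dist (encode (x (Suc n)) (from_nat k)) (encode (x n) (from_nat k))) 1)"
        by (simp add: dist_fun_def)
      also have "\<dots> \<le> (\<Sum>k. (1 / 2) ^ k * (1 / real (Suc n)))"
      proof (rule suminf_le)
        show "summable (\<lambda>k. (1/2)^k *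
            min (dist (encode (x (Suc n)) (from_nat k)) (encode (x n) (from_nat k))) 1)"
          by (rule summable_comparison_test'[OF sums_summable[OF geo], of 0])
             (simp add: mult_left_le)
      next
        show "summable (\<lambda>k. (1 / 2) ^ k * (1 / real (Suc n)))" using geo' by (rule sums_summable)
      qed (rule mult_left_mono[OF le], simp)
      also have "\<dots> = 2 * (1 / real (Suc n))" using geo' by (simp add: sums_iff)
      finally show ?thesis .
    qed
    have "(\<lambda>n. 2 * (1 / real (Suc n))) \<longlonglongrightarrow> 2 * 0"
      by (intro tendsto_mult tendsto_const) (use LIMSEQ_inverse_real_of_nat in \<open>simp add: inverse_eq_divide\<close>)
    then have null: "(\<lambda>n. 2 * (1 / real (Suc n))) \<longlonglongrightarrow> 0" by simp
    show "(\<lambda>n. dist (encode (x (Suc n))) (encode (x n))) \<longlonglongrightarrow> 0"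
    proof (rule tendsto_sandwich[OF _ _ tendsto_const null])
      show "\<forall>\<^sub>F n in sequentially. 0 \<le> dist (encode (x (Suc n))) (encode (x n))" by simp
      show "\<forall>\<^sub>F n in sequentially. dist (encode (x (Suc n))) (encode (x n)) \<le> 2 * (1 / real (Suc n))"
        using dist_le by (rule always_eventually[OF allI])
    qed
qed

lemma trajectory_limit_set_connected: "connected (limit_set x)"
  unfolding limit_set_x
  by (rule connected_continuous_image[OF continuous_on_decode connected_limit_set_encode])

text \<open>A finite, nonempty, connected limit set is a single point, and in a compact space a
  sequence with only one limit point converges to it.\<close>

lemma trajectory_converges:
  assumes "finite F" "limit_set x \<subseteq> F"
  shows "\<exists>y\<in>F. x \<longlonglongrightarrow> y"
proof -
  note compact = compact_unit_sequences encode_in_unit_sequences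
  have "finite (limit_set (\<lambda>n. encode (x n)))"
    unfolding limit_set_encode[of x, OF x_coord_space] using finite_subset[OF assms(2,1)] by simp
  then obtain a where a: "limit_set (\<lambda>n. encode (x n)) = {a}"
    using connected_finite_iff_sing[OF connected_limit_set_encode] limit_set_nonempty[OF compact]
    by auto
  have "(\<lambda>n. encode (x n)) \<longlonglongrightarrow> a" by (rule tendsto_limit_set_singleton[OF compact a])
  then have "(\<lambda>n. decode (encode (x n))) \<longlonglongrightarrow> decode a"
    by (rule continuous_on_tendsto_compose[OF continuous_on_decode[of UNIV]]) auto
  then have "x \<longlonglongrightarrow> decode a" by (simp add: decode_encode[OF x_coord_space])
  moreover have "decode a \<in> F" using assms(2) a unfolding limit_set_x by simp
  ultimately show ?thesis by blast
qed

end

text \<open>If the spread tends to 0, every closed sublevel set eventually contains the trajectory,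
  hence contains its limit points. Conversely, the trajectory eventually enters each open
  neighbourhood of its limit set, in particular each open sublevel set. The equivalence turns an
  event about limit sets into one about a real sequence.\<close>

lemma trajectory_limit_set_fixed_iff:
  "limit_set x \<subseteq> Fix \<longleftrightarrow> (\<lambda>n. spread (x n)) \<longlonglongrightarrow> 0"
proof
  assume lim: "(\<lambda>n. spread (x n)) \<longlonglongrightarrow> 0"
  show "limit_set x \<subseteq> Fix"
  proof
    fix y assume y: "y \<in> limit_set x"
    have "y \<in> D" using limit_set_subset[OF closed_simplex_prod, of 0 x] xD y by auto
    moreover have "spread y \<le> e" if "e > 0" for e
    proof -
      have "eventually (\<lambda>n. spread (x n) < e) sequentially" using order_tendstoD(2)[OF lim that] .
      then obtain N where N: "\<And>n. n \<ge> N \<Longrightarrow> spread (x n) < e" by (auto simp: eventually_sequentially)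
      have "closed {z. spread z \<le> e}"
        by (intro closed_Collect_le continuous_on_spread continuous_on_const)
      then have "limit_set x \<subseteq> {z. spread z \<le> e}"
        by (rule limit_set_subset[of _ N]) (use N in \<open>auto simp: less_imp_le\<close>)
      then show ?thesis using y by auto
    qed
    then have "spread y \<le> 0" by (meson field_le_epsilon add_0 dense_ge)
    ultimately show "y \<in> Fix" using fixed_points_iff_spread[of y] spread_nonneg[of y] by simp
  qed
next
  assume sub: "limit_set x \<subseteq> Fix"
  show "(\<lambda>n. spread (x n)) \<longlonglongrightarrow> 0"
  proof (rule order_tendstoI)
    fix a :: real assume "a < 0"
    then show "\<forall>\<^sub>F n in sequentially. a < spread (x n)"
      using spread_nonneg[OF xD] by (intro always_eventually allI) (rule less_le_trans)
  next
    fix a :: real assume a: "0 < a"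
    define U where "U = {z. spread (decode z) < a}"
    have "continuous_on UNIV (\<lambda>z. spread (decode z))"
      by (rule continuous_on_compose2[OF continuous_on_spread continuous_on_decode]) auto
    then have "open U" unfolding U_def by (intro open_Collect_less continuous_on_const)
    moreover have "limit_set (\<lambda>n. encode (x n)) \<subseteq> U"
    proof
      fix z assume "z \<in> limit_set (\<lambda>n. encode (x n))"
      then have "decode z \<in> Fix" using sub limit_set_x by auto
      moreover from this have "decode z \<in> D" by (auto simp: fixed_points_def)
      ultimately show "z \<in> U" using fixed_points_iff_spread a by (simp add: U_def)
    qed
    ultimately have "eventually (\<lambda>n. encode (x n) \<in> U) sequentially"
      by (rule eventually_near_limit_set[OF compact_unit_sequences encode_in_unit_sequences])
    then show "\<forall>\<^sub>F n in sequentially. spread (x n) < a"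
      by (simp add: U_def decode_encode[OF x_coord_space])
  qed
qed

text \<open>Only finitely many real sequences matter, so the convergence event is measurable
  whatever the size of the vertex type.\<close>

lemma tendsto_coord_space_iff:
  assumes "y \<in> coord_space m V"
  shows "x \<longlonglongrightarrow> y \<longleftrightarrow> (\<forall>(i, v)\<in>C. (\<lambda>n. x n i v) \<longlonglongrightarrow> y i v)"
proof
  assume lim: "x \<longlonglongrightarrow> y"
  then show "\<forall>(i, v)\<in>C. (\<lambda>n. x n i v) \<longlonglongrightarrow> y i v" by (auto simp: tendsto_fun_iff)
next
  assume lim: "\<forall>(i, v)\<in>C. (\<lambda>n. x n i v) \<longlonglongrightarrow> y i v"
  have l: "(\<lambda>n. x n i v) \<longlonglongrightarrow> y i v" for i v
  proof (cases "(i, v) \<in> C")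
    case False
    then show ?thesis using x_coord_space assms by (simp add: coord_space_def)
  qed (use lim in auto)
  show "x \<longlonglongrightarrow> y" using l by (simp add: tendsto_fun_iff)
qed

end

subsection \<open>Uniqueness from the determinant\<close>

lemma sum_C: "(\<Sum>p\<in>C. f p) = (\<Sum>j\<in>{1..m}. \<Sum>u\<in>V j. f (j, u))" for f :: "nat \<times> 'v \<Rightarrow> real"
proof -
  have "(\<Sum>j\<in>{1..m}. \<Sum>u\<in>V j. f (j, u)) = (\<Sum>(j, u)\<in>Sigma {1..m} V. f (j, u))"
    using V by (intro sum.Sigma) blast+
  then show ?thesis by (simp add: coords_def)
qed

lemma sum_C_vertex:
  "(\<Sum>(j, u)\<in>C. if u = w then g j u else 0) = (\<Sum>j\<in>walks_at m V w. g j w)"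
  for g :: "nat \<Rightarrow> 'v \<Rightarrow> real"
proof -
  have "(\<Sum>(j, u)\<in>C. if u = w then g j u else 0) = (\<Sum>j\<in>{1..m}. if w \<in> V j then g j w else 0)"
    unfolding sum_C using V by (intro sum.cong) (auto simp: sum.delta)
  also have "\<dots> = (\<Sum>j\<in>walks_at m V w. g j w)"
    unfolding walks_at_def by (rule sum.inter_filter[symmetric]) simp
  finally show ?thesis .
qed

text \<open>The difference of two solutions solves the homogeneous system, the constants \<eta> and
  1 having cancelled. The three cases are the three kinds of rows.\<close>

lemma system_coeff_kernel:
  assumes S: "S \<in> supports m V" and b: "\<And>i. i \<in> {1..m} \<Longrightarrow> b i \<in> S i"
    and x: "x \<in> positive_solutions m V \<eta> \<rho> S" and y: "y \<in> positive_solutions m V \<eta> \<rho> S"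
    and iv: "(i, v) \<in> C"
  shows "(\<Sum>(j, u)\<in>C. system_coeff \<rho> b S (i, v) (j, u) * (x j u - y j u)) = 0"
proof -
  have i: "i \<in> {1..m}" "v \<in> V i" using iv by (auto simp: mem_C)
  have Si: "S i \<subseteq> V i" using S i by (auto simp: supports_def)
  let ?d = "\<lambda>j u. x j u - y j u"
  consider "v \<notin> S i" | "v \<in> S i" "v = b i" | "v \<in> S i" "v \<noteq> b i" by blast
  then show ?thesis
  proof cases
    case 1
    have "(\<Sum>(j, u)\<in>C. system_coeff \<rho> b S (i, v) (j, u) * ?d j u) =
        (\<Sum>p\<in>C. if p = (i, v) then ?d i v else 0)"
      using 1 by (intro sum.cong) (auto simp: system_coeff_def split: if_splits)
    also have "\<dots> = ?d i v" using iv finite_C by simp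
    also have "x i v = 0" using 1 x i unfolding positive_solutions_def by blast
    also have "y i v = 0" using 1 y i unfolding positive_solutions_def by blast
    finally show ?thesis by simp
  next
    case 2
    have "(\<Sum>(j, u)\<in>C. system_coeff \<rho> b S (i, v) (j, u) * ?d j u) =
        (\<Sum>j\<in>{1..m}. \<Sum>u\<in>V j. if j = i \<and> u \<in> S i then ?d j u else 0)"
      unfolding sum_C using 2 by (intro sum.cong refl) (simp add: system_coeff_def)
    also have "\<dots> = (\<Sum>j\<in>{1..m}. if j = i then (\<Sum>u\<in>V i. if u \<in> S i then ?d i u else 0) else 0)"
      by (intro sum.cong) auto
    also have "\<dots> = (\<Sum>u\<in>V i. if u \<in> S i then ?d i u else 0)" using i by simp
    also have "\<dots> = (\<Sum>u\<in>S i. ?d i u)"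
      using Si V[OF i(1)] by (simp add: sum.inter_restrict[symmetric] Int_absorb1)
    also have "\<dots> = (\<Sum>u\<in>S i. x i u) - (\<Sum>u\<in>S i. y i u)" by (rule sum_subtractf)
    also have "(\<Sum>u\<in>S i. x i u) = 1" using x i unfolding positive_solutions_def by blast
    also have "(\<Sum>u\<in>S i. y i u) = 1" using y i unfolding positive_solutions_def by blast
    finally show ?thesis by simp
  next
    case 3
    have "(\<Sum>(j, u)\<in>C. system_coeff \<rho> b S (i, v) (j, u) * ?d j u) =
        (\<Sum>(j, u)\<in>C. if u = v then \<rho> i j u * ?d j u else 0) -
        (\<Sum>(j, u)\<in>C. if u = b i then \<rho> i j u * ?d j u else 0)"
      unfolding sum_subtractf[symmetric] using 3
      by (intro sum.cong refl) (auto simp: system_coeff_def algebra_simps)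
    also have "\<dots> = (h x i v - h y i v) - (h x i (b i) - h y i (b i))"
      unfolding sum_C_vertex by (simp add: affine_weight_def right_diff_distrib sum_subtractf)
    also have "h x i (b i) = h x i v"
      using x i(1) b[OF i(1)] 3 unfolding positive_solutions_def by blast
    also have "h y i (b i) = h y i v"
      using y i(1) b[OF i(1)] 3 unfolding positive_solutions_def by blast
    finally show ?thesis by simp
  qed
qed

lemma positive_solutions_unique:
  assumes S: "S \<in> supports m V" and b: "\<And>i. i \<in> {1..m} \<Longrightarrow> b i \<in> S i"
    and det: "Determinant.det (system_matrix m V \<rho> b S) \<noteq> 0"
    and x: "x \<in> positive_solutions m V \<eta> \<rho> S" and y: "y \<in> positive_solutions m V \<eta> \<rho> S"
  shows "x = y"
proof -
  let ?n = "card C" and ?e = "from_nat_into C" and ?A = "system_matrix m V \<rho> b S"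
  define d where "d = (\<lambda>(i, v). x i v - y i v)"
  define z where "z = Matrix.vec ?n (\<lambda>c. d (?e c))"
  have bij: "bij_betw ?e {..<?n} C" by (rule bij_betw_from_nat_into_finite[OF finite_C])
  have A: "?A \<in> carrier_mat ?n ?n" by (simp add: system_matrix_def)
  have z: "z \<in> carrier_vec ?n" by (simp add: z_def)
  have "mult_mat_vec ?A z = 0\<^sub>v ?n"
  proof (rule eq_vecI)
    fix r assume "r < dim_vec (0\<^sub>v ?n :: real Matrix.vec)"
    then have r: "r < ?n" by simp
    then have eC: "?e r \<in> C" using bij by (auto simp: bij_betw_def)
    have "vec_index (mult_mat_vec ?A z) r = (\<Sum>c\<in>{..<?n}. system_coeff \<rho> b S (?e r) (?e c) * d (?e c))"
      using r A z by (simp add: scalar_prod_def system_matrix_def z_def lessThan_atLeast0)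
    also have "\<dots> = (\<Sum>p\<in>C. system_coeff \<rho> b S (?e r) p * d p)"
      by (rule sum.reindex_bij_betw[OF bij])
    also have "\<dots> = 0"
      using system_coeff_kernel[OF S b x y, of "fst (?e r)" "snd (?e r)"] eC
      by (simp add: d_def case_prod_unfold)
    finally show "vec_index (mult_mat_vec ?A z) r = vec_index (0\<^sub>v ?n) r" using r by simp
  qed (use A in simp)
  then have z0: "z = 0\<^sub>v ?n"
    using det det_0_iff_vec_prod_zero_field[OF A] z by blast
  have "d p = 0" if "p \<in> C" for p
  proof -
    have "p \<in> ?e ` {..<?n}" unfolding bij_betw_imp_surj_on[OF bij] by (rule that)
    then obtain c where "c < ?n" "p = ?e c" by blast
    then have "d p = vec_index z c" by (simp add: z_def)
    then show ?thesis using z0 \<open>c < ?n\<close> by simp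
  qed
  then have "x i v = y i v" if "(i, v) \<in> C" for i v using that by (force simp: d_def)
  moreover have "x i v = y i v" if "(i, v) \<notin> C" for i v
    using that x y by (simp add: positive_solutions_def coord_space_def)
  ultimately show ?thesis by (intro ext) blast
qed

text \<open>Each of the finitely many supports carries at most one solution: a nonsingular matrix
  has trivial kernel, and an empty component turns the normalisation into 0 = 1.\<close>

lemma finite_fixed_points:
  assumes b: "\<And>S i. S \<in> supports m V \<Longrightarrow> (\<forall>k\<in>{1..m}. S k \<noteq> {}) \<Longrightarrow> i \<in> {1..m} \<Longrightarrow> b S i \<in> S i"
    and det: "\<And>S. S \<in> supports m V \<Longrightarrow> (\<forall>i\<in>{1..m}. S i \<noteq> {}) \<Longrightarrow>
      Determinant.det (system_matrix m V \<rho> (b S) S) \<noteq> 0"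
  shows "finite Fix"
  unfolding fixed_points_eq
proof (intro finite_UN_I finite_supports)
  fix S assume S: "S \<in> supports m V"
  show "finite (positive_solutions m V \<eta> \<rho> S)"
  proof (cases "\<forall>i\<in>{1..m}. S i \<noteq> {}")
    case True
    then have "x = y" if "x \<in> positive_solutions m V \<eta> \<rho> S" "y \<in> positive_solutions m V \<eta> \<rho> S" for x y
      using positive_solutions_unique[of S "b S" x y] b det S that by blast
    then have "positive_solutions m V \<eta> \<rho> S \<subseteq> {x}" if "x \<in> positive_solutions m V \<eta> \<rho> S" for x
      using that by blast
    then show ?thesis by (metis equals0I finite.emptyI finite.insertI finite_subset)
  next
    case False
    then obtain i where i: "i \<in> {1..m}" "S i = {}" by blast
    have False if "x \<in> positive_solutions m V \<eta> \<rho> S" for x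
    proof -
      have "(\<Sum>l\<in>S i. x i l) = 1" using that i(1) unfolding positive_solutions_def by blast
      then show False using i(2) by simp
    qed
    then have "positive_solutions m V \<eta> \<rho> S = {}" by blast
    then show ?thesis by simp
  qed
qed

end

section \<open>The walks\<close>

text \<open>Sum and integral are exchanged in the extended nonnegative reals, and a function with
  finite integral is finite almost everywhere.\<close>

lemma AE_summable_if_summable_integral:
  fixes f :: "nat \<Rightarrow> 'a \<Rightarrow> real"
  assumes int: "\<And>n. integrable M (f n)" and nonneg: "\<And>n x. x \<in> space M \<Longrightarrow> 0 \<le> f n x"
    and sm: "summable (\<lambda>n. integral\<^sup>L M (f n))"
  shows "AE x in M. summable (\<lambda>n. f n x)"
proof -
  have [measurable]: "f n \<in> borel_measurable M" for n using int by auto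
  have nn: "0 \<le> integral\<^sup>L M (f n)" for n using nonneg by (intro integral_nonneg_AE AE_I2)
  have "(\<integral>\<^sup>+x. (\<Sum>n. ennreal (f n x)) \<partial>M) = (\<Sum>n. \<integral>\<^sup>+x. ennreal (f n x) \<partial>M)"
    by (intro nn_integral_suminf) simp
  also have "\<dots> = (\<Sum>n. ennreal (integral\<^sup>L M (f n)))"
    using int nonneg by (intro suminf_cong nn_integral_eq_integral AE_I2)
  also have "\<dots> = ennreal (\<Sum>n. integral\<^sup>L M (f n))"
    using sm nn by (intro suminf_ennreal2)
  finally have "(\<integral>\<^sup>+x. (\<Sum>n. ennreal (f n x)) \<partial>M) \<noteq> \<infinity>" by simp
  then have "AE x in M. (\<Sum>n. ennreal (f n x)) \<noteq> \<infinity>"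
    by (intro nn_integral_PInf_AE) simp_all
  then show ?thesis
  proof (rule AE_mp, intro AE_I2 impI)
    fix x assume "x \<in> space M" "(\<Sum>n. ennreal (f n x)) \<noteq> \<infinity>"
    then show "summable (\<lambda>n. f n x)"
      using nonneg by (intro summable_suminf_not_top) (simp_all add: infinity_ennreal_def)
  qed
qed

locale reinforced_walks = interaction_model m V \<alpha> \<eta> \<rho> + prob_space M
  for m :: nat and V :: "nat \<Rightarrow> 'v set" and \<alpha> :: real
    and \<eta> :: "nat \<Rightarrow> 'v \<Rightarrow> real" and \<rho> :: "nat \<Rightarrow> nat \<Rightarrow> 'v \<Rightarrow> real"
    and M :: "'w measure" +
  fixes W :: "nat \<Rightarrow> nat \<Rightarrow> 'w \<Rightarrow> 'v"
  assumes W: "\<And>i n. i \<in> {1..m} \<Longrightarrow> n \<ge> 1 \<Longrightarrow> W i n \<in> measurable M (count_space (V i))"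
    and W_step: "\<And>i v n. i \<in> {1..m} \<Longrightarrow> v \<in> V i \<Longrightarrow>
              (AE \<omega> in M. real_cond_exp M (walk_history M m V W n)
                   (indicat_real {\<omega> \<in> space M. W i (n + 1) \<omega> = v}) \<omega> =
                 transition m V \<alpha> \<eta> \<rho> (occupation m V W n \<omega>) i v)"
begin

abbreviation "X \<equiv> occupation m V W"
abbreviation "\<F> \<equiv> walk_history M m V W"

lemma card_V_pos: "i \<in> {1..m} \<Longrightarrow> card (V i) > 0"
  using V by (simp add: card_gt_0_iff)

lemma W_in_V:
  assumes "\<omega> \<in> space M" "i \<in> {1..m}" "n \<ge> 1"
  shows "W i n \<omega> \<in> V i"
  using measurable_space[OF W[OF assms(2,3)] assms(1)] by simp

lemma occupation_in_D:
  assumes \<omega>: "\<omega> \<in> space M"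
  shows "X n \<omega> \<in> D"
proof -
  have "(\<Sum>v\<in>V i. X n \<omega> i v) = 1" if i: "i \<in> {1..m}" for i
  proof -
    have "(\<Sum>v\<in>V i. \<Sum>k=1..n. of_bool (W i k \<omega> = v)) = (\<Sum>k=1..n. \<Sum>v\<in>V i. of_bool (W i k \<omega> = v) :: real)"
      by (rule sum.swap)
    also have "\<dots> = (\<Sum>k=1..n. 1)"
    proof (rule sum.cong[OF refl])
      fix k assume "k \<in> {1..n}"
      then have "W i k \<omega> \<in> V i" using W_in_V[OF \<omega> i] by simp
      then show "(\<Sum>v\<in>V i. of_bool (W i k \<omega> = v) :: real) = 1"
        using V[OF i] by (simp add: of_bool_def)
    qed
    finally have s: "(\<Sum>v\<in>V i. \<Sum>k=1..n. of_bool (W i k \<omega> = v) :: real) = n" by simp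
    have "(\<Sum>v\<in>V i. X n \<omega> i v) =
        (\<Sum>v\<in>V i. (1 + (\<Sum>k=1..n. of_bool (W i k \<omega> = v))) / real (card (V i) + n))"
      using i by (intro sum.cong) (auto simp: occupation_def mem_C)
    also have "\<dots> = (real (card (V i)) + real n) / real (card (V i) + n)"
      unfolding sum_divide_distrib[symmetric] sum.distrib s by simp
    also have "\<dots> = 1" using card_V_pos[OF i] by simp
    finally show ?thesis .
  qed
  then show ?thesis
    by (auto simp: simplex_prod_def coord_space_def occupation_def intro!: divide_nonneg_nonneg add_nonneg_nonneg sum_nonneg)
qed

text \<open>The recursion of stochastic approximation: the increment is the new observation minus
  the current value, scaled by a step size that depends on the walk.\<close>

lemma occupation_Suc:
  assumes "(i, v) \<in> C"
  shows "X (Suc n) \<omega> i v - X n \<omega> i v =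
    (of_bool (W i (Suc n) \<omega> = v) - X n \<omega> i v) / real (card (V i) + Suc n)"
proof -
  define s where "s = 1 + (\<Sum>k=1..n. of_bool (W i k \<omega> = v) :: real)"
  define N where "N = real (card (V i) + n)"
  define w where "w = (of_bool (W i (Suc n) \<omega> = v) :: real)"
  have "N > 0" using card_V_pos[of i] assms by (simp add: N_def mem_C)
  have "X n \<omega> i v = s / N" "X (Suc n) \<omega> i v = (s + w) / (N + 1)"
    using assms by (simp_all add: occupation_def s_def N_def w_def add_ac)
  moreover have "real (card (V i) + Suc n) = N + 1" by (simp add: N_def)
  moreover have "(s + w) / (N + 1) - s / N = (w - s / N) / (N + 1)"
    using \<open>N > 0\<close> by (simp add: field_simps)
  ultimately show ?thesis by (simp add: w_def)
qed

lemma occupation_slow: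
  assumes "\<omega> \<in> space M"
  shows "\<bar>X (Suc n) \<omega> i v - X n \<omega> i v\<bar> \<le> 1 / real (Suc n)"
proof (cases "(i, v) \<in> C")
  case True
  have "\<bar>of_bool (W i (Suc n) \<omega> = v) - X n \<omega> i v\<bar> \<le> 1"
    using simplex_prod_bounds[OF occupation_in_D[OF assms], of n i v] by auto
  then have "\<bar>of_bool (W i (Suc n) \<omega> = v) - X n \<omega> i v\<bar> / real (card (V i) + Suc n) \<le> 1 / real (Suc n)"
    by (intro frac_le) auto
  then show ?thesis unfolding occupation_Suc[OF True] by (simp add: abs_divide)
qed (simp add: occupation_def)

subsection \<open>Measurability\<close>

lemma W_vimage_sets: "i \<in> {1..m} \<Longrightarrow> n \<ge> 1 \<Longrightarrow> A \<subseteq> V i \<Longrightarrow> W i n -` A \<inter> space M \<in> sets M"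
  by (rule measurable_sets[OF W]) auto

lemma subalgebra_walk_history: "subalgebra M (\<F> n)"
proof -
  have "sets (\<F> n) \<subseteq> sets M"
    unfolding walk_history_def using W_vimage_sets
    by (subst sets_measure_of) (auto intro!: sets.sigma_sets_subset)
  then show ?thesis by (simp add: subalgebra_def walk_history_def space_measure_of_conv)
qed

lemma space_walk_history: "space (\<F> n) = space M"
  by (simp add: walk_history_def space_measure_of_conv)

lemma pred_W_walk_history:
  assumes "(i, v) \<in> C" "k \<in> {1..n}"
  shows "Measurable.pred (\<F> n) (\<lambda>\<omega>. W i k \<omega> = v)"
proof -
  have "W i k -` {v} \<inter> space M \<in> {W i k -` A \<inter> space M | i k A. i \<in> {1..m} \<and> k \<in> {1..n} \<and> A \<subseteq> V i}"
    by (rule CollectI, rule exI[of _ i], rule exI[of _ k], rule exI[of _ "{v}"])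
       (use assms in \<open>auto simp: mem_C\<close>)
  then have "W i k -` {v} \<inter> space M \<in> sets (\<F> n)"
    unfolding walk_history_def by (subst sets_measure_of) (auto intro: sigma_sets.Basic)
  moreover have "W i k -` {v} \<inter> space M = {\<omega> \<in> space (\<F> n). W i k \<omega> = v}"
    by (auto simp: space_walk_history)
  ultimately show ?thesis by (simp add: pred_def)
qed

lemma pred_W:
  assumes "(i, v) \<in> C"
  shows "Measurable.pred M (\<lambda>\<omega>. W i (Suc k) \<omega> = v)"
  using measurable_from_subalg[OF subalgebra_walk_history pred_W_walk_history[OF assms, of "Suc k" "Suc k"]]
  by simp

lemma occupation_measurable_walk_history: "(\<lambda>\<omega>. X n \<omega> i v) \<in> borel_measurable (\<F> n)"
proof (cases "(i, v) \<in> C")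
  case True
  have "(\<lambda>\<omega>. of_bool (W i k \<omega> = v) :: real) \<in> borel_measurable (\<F> n)" if "k \<in> {1..n}" for k
    unfolding of_bool_def using pred_W_walk_history[OF True that] by measurable
  then have "(\<lambda>\<omega>. (1 + (\<Sum>k=1..n. of_bool (W i k \<omega> = v))) / real (card (V i) + n)) \<in> borel_measurable (\<F> n)"
    by (intro borel_measurable_divide borel_measurable_add borel_measurable_sum borel_measurable_const)
  then show ?thesis using True by (simp add: occupation_def)
qed (simp add: occupation_def)

lemma occupation_measurable [measurable]: "(\<lambda>\<omega>. X n \<omega> i v) \<in> borel_measurable M"
  by (rule measurable_from_subalg[OF subalgebra_walk_history occupation_measurable_walk_history])

lemma affine_weight_measurable_walk_history: "(\<lambda>\<omega>. h (X n \<omega>) i v) \<in> borel_measurable (\<F> n)"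
  unfolding affine_weight_def
  by (intro borel_measurable_add borel_measurable_sum borel_measurable_times borel_measurable_const
      occupation_measurable_walk_history)

lemma affine_weight_measurable [measurable]: "(\<lambda>\<omega>. h (X n \<omega>) i v) \<in> borel_measurable M"
  by (rule measurable_from_subalg[OF subalgebra_walk_history affine_weight_measurable_walk_history])

lemma transition_measurable [measurable]: "(\<lambda>\<omega>. \<pi> (X n \<omega>) i v) \<in> borel_measurable M"
  unfolding transition_def weight_def by measurable

lemma spread_measurable [measurable]: "(\<lambda>\<omega>. spread (X n \<omega>)) \<in> borel_measurable M"
  unfolding spread_def by measurable

lemma potential_measurable [measurable]: "(\<lambda>\<omega>. potential (X n \<omega>)) \<in> borel_measurable M"
  unfolding potential_def by measurable

lemma integrable_bounded_lipschitz:
  assumes "bounded_lipschitz f" "(\<lambda>\<omega>. f (X n \<omega>)) \<in> borel_measurable M"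
  shows "integrable M (\<lambda>\<omega>. f (X n \<omega>))"
proof -
  obtain K where "\<And>x. x \<in> D \<Longrightarrow> \<bar>f x\<bar> \<le> K"
    using assms(1) unfolding bounded_lipschitz_def by blast
  then show ?thesis
    using occupation_in_D by (intro integrable_const_bound[where B = K] assms(2) AE_I2) auto
qed

subsection \<open>Almost sure convergence of the spread to zero\<close>

lemma transition_bounds:
  assumes "x \<in> D"
  shows "0 \<le> \<pi> x i v" "\<pi> x i v \<le> 1"
proof -
  have "0 \<le> \<pi> x i v \<and> \<pi> x i v \<le> 1"
  proof (cases "(i, v) \<in> C")
    case True
    then have i: "i \<in> {1..m}" "v \<in> V i" by (auto simp: mem_C)
    have nn: "x i w * H x i w \<ge> 0" for w
      using simplex_prod_bounds(1)[OF assms] by (simp add: weight_def)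
    have "x i v * H x i v \<le> (\<Sum>w\<in>V i. x i w * H x i w)"
      using nn i V[OF i(1)] by (intro member_le_sum) auto
    then show ?thesis
      using True nn total_weight_pos[OF assms i(1)] by (simp add: transition_def)
  qed (simp add: transition_def)
  then show "0 \<le> \<pi> x i v" "\<pi> x i v \<le> 1" by auto
qed

lemma integrable_weighted:
  assumes f: "f \<in> borel_measurable M" and B: "\<And>\<omega>. \<omega> \<in> space M \<Longrightarrow> \<bar>f \<omega>\<bar> \<le> B"
  shows "integrable M (\<lambda>\<omega>. h (X n \<omega>) i v * f \<omega>)"
proof -
  obtain K where K: "\<And>x. x \<in> D \<Longrightarrow> \<bar>h x i v\<bar> \<le> K"
    using bounded_lipschitz_affine_weight[of i v] unfolding bounded_lipschitz_def by blast
  have "\<bar>h (X n \<omega>) i v * f \<omega>\<bar> \<le> K * B" if "\<omega> \<in> space M" for \<omega>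
    unfolding abs_mult using K[OF occupation_in_D[OF that, of n]] B[OF that] by (intro mult_mono) auto
  then show ?thesis
    using f by (intro integrable_const_bound[where B = "K * B"] AE_I2) auto
qed

text \<open>The factor \<open>h (X n \<omega>) i v\<close> is bounded and depends only on the first
  \<open>n\<close> steps, so the indicator of the next position may be replaced by its conditional
  expectation, which is \<pi>.\<close>

lemma integral_step:
  assumes "(i, v) \<in> C"
  shows "(\<integral>\<omega>. h (X n \<omega>) i v * (of_bool (W i (Suc n) \<omega> = v) - X n \<omega> i v) \<partial>M) =
    (\<integral>\<omega>. h (X n \<omega>) i v * (\<pi> (X n \<omega>) i v - X n \<omega> i v) \<partial>M)"
proof -
  interpret F: finite_measure_subalgebra M "\<F> n"
    by unfold_locales (rule subalgebra_walk_history)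
  have i: "i \<in> {1..m}" "v \<in> V i" using assms by (auto simp: mem_C)
  let ?g = "indicat_real {\<omega> \<in> space M. W i (n + 1) \<omega> = v}"
  have [measurable]: "Measurable.pred M (\<lambda>\<omega>. W i (Suc n) \<omega> = v)" by (rule pred_W[OF assms])
  have ob [measurable]: "(\<lambda>\<omega>. of_bool (W i (Suc n) \<omega> = v) :: real) \<in> borel_measurable M"
    unfolding of_bool_def by measurable
  have g [measurable]: "?g \<in> borel_measurable M" by simp
  have int: "integrable M (\<lambda>\<omega>. h (X n \<omega>) i v * ?g \<omega>)"
      "integrable M (\<lambda>\<omega>. h (X n \<omega>) i v * of_bool (W i (Suc n) \<omega> = v))"
      "integrable M (\<lambda>\<omega>. h (X n \<omega>) i v * \<pi> (X n \<omega>) i v)"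
      "integrable M (\<lambda>\<omega>. h (X n \<omega>) i v * X n \<omega> i v)"
    using transition_bounds[OF occupation_in_D] simplex_prod_bounds[OF occupation_in_D]
    by (auto intro!: integrable_weighted[where B = 1] simp: indicator_def)
  have "(\<integral>\<omega>. h (X n \<omega>) i v * of_bool (W i (Suc n) \<omega> = v) \<partial>M) = (\<integral>\<omega>. h (X n \<omega>) i v * ?g \<omega> \<partial>M)"
    by (intro Bochner_Integration.integral_cong) (auto simp: indicator_def)
  also have "\<dots> = (\<integral>\<omega>. h (X n \<omega>) i v * real_cond_exp M (\<F> n) ?g \<omega> \<partial>M)"
    by (rule F.real_cond_exp_intg(2)[symmetric, OF int(1) affine_weight_measurable_walk_history g])
  also have "\<dots> = (\<integral>\<omega>. h (X n \<omega>) i v * \<pi> (X n \<omega>) i v \<partial>M)"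
    using W_step[OF i, of n]
    by (intro integral_cong_AE) (auto intro: borel_measurable_times borel_measurable_cond_exp2)
  finally show ?thesis using int by (simp add: right_diff_distrib)
qed

text \<open>The first-order part of the expansion has the expected drift as its mean. The error is
  the quadratic remainder for increments of size at most \<open>1 / real (Suc n)\<close>.\<close>

lemma expected_potential_increment_ge:
  obtains \<kappa> R N where "\<kappa> > 0" "R \<ge> 0"
    "\<And>n. (\<integral>\<omega>. potential (X (Suc n) \<omega>) \<partial>M) - (\<integral>\<omega>. potential (X n \<omega>) \<partial>M) \<ge>
      \<kappa> * (\<integral>\<omega>. spread (X n \<omega>) / real (N + Suc n) \<partial>M) - R / real (Suc n)^2"
proof -
  obtain \<kappa> where \<kappa>: "\<kappa> > 0"
    "\<And>x i. x \<in> D \<Longrightarrow> i \<in> {1..m} \<Longrightarrow>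
       \<kappa> * (\<Sum>v\<in>V i. \<Sum>w\<in>V i. x i v * x i w * (h x i v - h x i w)^2) \<le>
       (\<Sum>v\<in>V i. h x i v * (\<pi> x i v - x i v))"
    using drift_ge_spread by blast
  obtain R where R: "R \<ge> 0"
    "\<And>x y \<delta>. (\<And>i v. \<bar>y i v - x i v\<bar> \<le> \<delta>) \<Longrightarrow>
       potential y - potential x \<ge> (\<Sum>i\<in>{1..m}. \<Sum>v\<in>V i. h x i v * (y i v - x i v)) - R * \<delta>^2"
    using potential_increment_ge by blast
  \<comment> \<open>Bounding every \<open>card (V i)\<close> by \<open>N\<close> gives one step size
    below all the others; it may replace them because each walk's share of the spread is
    nonnegative.\<close>
  define N where "N = (\<Sum>i\<in>{1..m}. card (V i))"
  have cardN: "card (V i) \<le> N" if "i \<in> {1..m}" for i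
    unfolding N_def using that by (intro member_le_sum) auto
  show thesis
  proof (rule that[OF \<kappa>(1) R(1)])
    fix n
    let ?c = "\<lambda>i. real (card (V i) + Suc n)"
    let ?G = "\<lambda>\<omega>. \<Sum>i\<in>{1..m}. \<Sum>v\<in>V i. h (X n \<omega>) i v * (X (Suc n) \<omega> i v - X n \<omega> i v)"
    let ?P = "\<lambda>\<omega>. \<Sum>i\<in>{1..m}. \<Sum>v\<in>V i. h (X n \<omega>) i v * (\<pi> (X n \<omega>) i v - X n \<omega> i v) / ?c i"
    have int_pot: "integrable M (\<lambda>\<omega>. potential (X k \<omega>))" for k
      by (intro integrable_bounded_lipschitz bounded_lipschitz_potential potential_measurable)
    have int_spread: "integrable M (\<lambda>\<omega>. spread (X n \<omega>))"
      by (intro integrable_bounded_lipschitz bounded_lipschitz_spread spread_measurable)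
    have int_G: "integrable M (\<lambda>\<omega>. h (X n \<omega>) i v * (X (Suc n) \<omega> i v - X n \<omega> i v))" for i v
      by (rule integrable_weighted[OF _ occupation_slow]) simp_all
    have int_P: "integrable M (\<lambda>\<omega>. h (X n \<omega>) i v * (\<pi> (X n \<omega>) i v - X n \<omega> i v))" for i v
    proof (rule integrable_weighted[where B = 1])
      fix \<omega> assume "\<omega> \<in> space M"
      then have "X n \<omega> \<in> D" by (rule occupation_in_D)
      then show "\<bar>\<pi> (X n \<omega>) i v - X n \<omega> i v\<bar> \<le> 1"
        using transition_bounds[of "X n \<omega>" i v] simplex_prod_bounds[of "X n \<omega>" i v] by linarith
    qed simp
    have "\<kappa> * (\<integral>\<omega>. spread (X n \<omega>) / real (N + Suc n) \<partial>M) =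
        (\<integral>\<omega>. \<kappa> * (spread (X n \<omega>) / real (N + Suc n)) \<partial>M)" by simp
    also have "\<dots> \<le> (\<integral>\<omega>. ?P \<omega> \<partial>M)"
    proof (rule integral_mono)
      show "integrable M (\<lambda>\<omega>. \<kappa> * (spread (X n \<omega>) / real (N + Suc n)))" using int_spread by simp
      show "integrable M ?P" using int_P by (intro Bochner_Integration.integrable_sum integrable_divide)
      fix \<omega> assume "\<omega> \<in> space M"
      then have x: "X n \<omega> \<in> D" by (rule occupation_in_D)
      let ?x = "X n \<omega>"
      let ?Q = "\<lambda>i. \<Sum>v\<in>V i. \<Sum>w\<in>V i. ?x i v * ?x i w * (h ?x i v - h ?x i w)^2"
      have "\<kappa> * ?Q i / real (N + Suc n) \<le> (\<Sum>v\<in>V i. h ?x i v * (\<pi> ?x i v - ?x i v) / ?c i)"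
        if i: "i \<in> {1..m}" for i
      proof -
        have "0 \<le> ?Q i" by (intro sum_nonneg spread_term_nonneg[OF x])
        then have "\<kappa> * ?Q i / real (N + Suc n) \<le> \<kappa> * ?Q i / ?c i"
          using \<kappa>(1) cardN[OF i] by (intro divide_left_mono mult_nonneg_nonneg mult_pos_pos) auto
        also have "\<dots> \<le> (\<Sum>v\<in>V i. h ?x i v * (\<pi> ?x i v - ?x i v)) / ?c i"
          by (intro divide_right_mono \<kappa>(2)[OF x i]) simp
        finally show ?thesis by (simp add: sum_divide_distrib)
      qed
      then have "(\<Sum>i\<in>{1..m}. \<kappa> * ?Q i / real (N + Suc n)) \<le> ?P \<omega>" by (rule sum_mono)
      also have "(\<Sum>i\<in>{1..m}. \<kappa> * ?Q i / real (N + Suc n)) = \<kappa> * (spread ?x / real (N + Suc n))"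
        by (simp only: spread_def sum_divide_distrib[symmetric] sum_distrib_left[symmetric] times_divide_eq_right)
      finally show "\<kappa> * (spread ?x / real (N + Suc n)) \<le> ?P \<omega>" .
    qed
    also have "\<dots> = (\<Sum>i\<in>{1..m}. \<Sum>v\<in>V i. (\<integral>\<omega>. h (X n \<omega>) i v * (\<pi> (X n \<omega>) i v - X n \<omega> i v) \<partial>M) / ?c i)"
      using int_P by simp
    also have "\<dots> = (\<Sum>i\<in>{1..m}. \<Sum>v\<in>V i. \<integral>\<omega>. h (X n \<omega>) i v * (X (Suc n) \<omega> i v - X n \<omega> i v) \<partial>M)"
    proof (intro sum.cong refl)
      fix i v assume "i \<in> {1..m}" "v \<in> V i"
      then have iv: "(i, v) \<in> C" by (simp add: mem_C)
      show "(\<integral>\<omega>. h (X n \<omega>) i v * (\<pi> (X n \<omega>) i v - X n \<omega> i v) \<partial>M) / ?c i =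
          (\<integral>\<omega>. h (X n \<omega>) i v * (X (Suc n) \<omega> i v - X n \<omega> i v) \<partial>M)"
        unfolding occupation_Suc[OF iv] integral_step[OF iv, symmetric] times_divide_eq_right
        by (rule integral_divide_zero[symmetric])
    qed
    also have "\<dots> = (\<integral>\<omega>. ?G \<omega> \<partial>M)" using int_G by simp
    finally have drift: "\<kappa> * (\<integral>\<omega>. spread (X n \<omega>) / real (N + Suc n) \<partial>M) \<le> (\<integral>\<omega>. ?G \<omega> \<partial>M)" .
    have "(\<integral>\<omega>. ?G \<omega> \<partial>M) - R / real (Suc n)^2 = (\<integral>\<omega>. ?G \<omega> - R * (1 / real (Suc n))^2 \<partial>M)"
      using int_G by (simp add: power_divide prob_space)
    also have "\<dots> \<le> (\<integral>\<omega>. potential (X (Suc n) \<omega>) - potential (X n \<omega>) \<partial>M)"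
    proof (rule integral_mono)
      show "integrable M (\<lambda>\<omega>. ?G \<omega> - R * (1 / real (Suc n))^2)" using int_G by simp
      show "integrable M (\<lambda>\<omega>. potential (X (Suc n) \<omega>) - potential (X n \<omega>))" using int_pot by simp
      fix \<omega> assume "\<omega> \<in> space M"
      then show "?G \<omega> - R * (1 / real (Suc n))^2 \<le> potential (X (Suc n) \<omega>) - potential (X n \<omega>)"
        by (intro R(2) occupation_slow)
    qed
    also have "\<dots> = (\<integral>\<omega>. potential (X (Suc n) \<omega>) \<partial>M) - (\<integral>\<omega>. potential (X n \<omega>) \<partial>M)"
      using int_pot by (intro Bochner_Integration.integral_diff)
    finally show "(\<integral>\<omega>. potential (X (Suc n) \<omega>) \<partial>M) - (\<integral>\<omega>. potential (X n \<omega>) \<partial>M) \<ge>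
      \<kappa> * (\<integral>\<omega>. spread (X n \<omega>) / real (N + Suc n) \<partial>M) - R / real (Suc n)^2"
      using drift by linarith
  qed
qed

text \<open>The expected increments of the potential telescope to at most \<open>2 * B\<close>, and
  the errors are summable, which bounds the partial sums of \<open>a\<close>.\<close>

lemma AE_spread_tendsto_0: "AE \<omega> in M. (\<lambda>n. spread (X n \<omega>)) \<longlonglongrightarrow> 0"
proof -
  obtain \<kappa> R N where \<kappa>: "\<kappa> > 0" and R: "R \<ge> 0" and
    incr: "\<And>n. (\<integral>\<omega>. potential (X (Suc n) \<omega>) \<partial>M) - (\<integral>\<omega>. potential (X n \<omega>) \<partial>M) \<ge>
      \<kappa> * (\<integral>\<omega>. spread (X n \<omega>) / real (N + Suc n) \<partial>M) - R / real (Suc n)^2"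
    by (rule expected_potential_increment_ge) (rule that)
  define a where "a n = (\<integral>\<omega>. spread (X n \<omega>) / real (N + Suc n) \<partial>M)" for n
  define p where "p n = (\<integral>\<omega>. potential (X n \<omega>) \<partial>M)" for n
  have spread_nn: "0 \<le> spread (X n \<omega>) / real (N + Suc n)" if "\<omega> \<in> space M" for n \<omega>
    using spread_nonneg[OF occupation_in_D[OF that]] by simp
  have int_spread: "integrable M (\<lambda>\<omega>. spread (X n \<omega>) / real (N + Suc n))" for n
    by (intro integrable_divide integrable_bounded_lipschitz bounded_lipschitz_spread spread_measurable)
  have a_nn: "0 \<le> a n" for n
    unfolding a_def using spread_nn by (intro integral_nonneg_AE AE_I2)
  obtain B where B: "\<And>x. x \<in> D \<Longrightarrow> \<bar>potential x\<bar> \<le> B"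
    using bounded_lipschitz_potential unfolding bounded_lipschitz_def by blast
  have p_bound: "\<bar>p n\<bar> \<le> B" for n
  proof -
    have "\<bar>p n\<bar> \<le> (\<integral>\<omega>. \<bar>potential (X n \<omega>)\<bar> \<partial>M)"
      unfolding p_def by (rule integral_abs_bound)
    also have "\<dots> \<le> (\<integral>\<omega>. B \<partial>M)"
      using B[OF occupation_in_D] integrable_bounded_lipschitz[OF bounded_lipschitz_potential potential_measurable, of n]
      by (intro integral_mono integrable_abs) auto
    finally show ?thesis by (simp add: prob_space)
  qed
  have sq: "summable (\<lambda>n. 1 / real (Suc n) ^ 2)"
    using inverse_squares_sums by (auto simp: sums_iff add.commute)
  have "(\<Sum>k<n. a k) \<le> (2 * B + R * (\<Sum>k. 1 / real (Suc k) ^ 2)) / \<kappa>" for n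
  proof -
    have "\<kappa> * (\<Sum>k<n. a k) \<le> (\<Sum>k<n. (p (Suc k) - p k) + R * (1 / real (Suc k)^2))"
      unfolding sum_distrib_left
    proof (rule sum_mono)
      fix k show "\<kappa> * a k \<le> (p (Suc k) - p k) + R * (1 / real (Suc k)^2)"
        using incr[of k] by (simp add: a_def p_def)
    qed
    also have "\<dots> = (p n - p 0) + R * (\<Sum>k<n. 1 / real (Suc k)^2)"
      by (simp only: sum.distrib sum_lessThan_telescope sum_distrib_left)
    also have "\<dots> \<le> 2 * B + R * (\<Sum>k. 1 / real (Suc k)^2)"
      using p_bound[of n] p_bound[of 0] R
      by (intro add_mono mult_left_mono sum_le_suminf[OF sq]) auto
    finally show ?thesis using \<kappa> by (simp add: pos_le_divide_eq mult.commute)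
  qed
  then have "summable a" by (rule summableI_nonneg_bounded[OF a_nn])
  then have "AE \<omega> in M. summable (\<lambda>n. spread (X n \<omega>) / real (N + Suc n))"
    by (intro AE_summable_if_summable_integral int_spread spread_nn) (simp_all add: a_def[abs_def])
  then show ?thesis
  proof (rule AE_mp, intro AE_I2 impI)
    fix \<omega> assume \<omega>: "\<omega> \<in> space M"
      and sm: "summable (\<lambda>n. spread (X n \<omega>) / real (N + Suc n))"
    obtain K where K: "\<And>x y \<delta>. x \<in> D \<Longrightarrow> y \<in> D \<Longrightarrow> (\<And>i v. \<bar>x i v - y i v\<bar> \<le> \<delta>) \<Longrightarrow>
        \<bar>spread x - spread y\<bar> \<le> K * \<delta>" "\<And>x. x \<in> D \<Longrightarrow> \<bar>spread x\<bar> \<le> K"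
      using bounded_lipschitz_spread unfolding bounded_lipschitz_def by blast
    have "K \<ge> 0" using K(2)[OF occupation_in_D[OF \<omega>, of 0]] by linarith
    show "(\<lambda>n. spread (X n \<omega>)) \<longlonglongrightarrow> 0"
    proof (rule tendsto_0_if_harmonic_sum[OF _ _ sm])
      show "0 \<le> spread (X n \<omega>)" for n by (rule spread_nonneg[OF occupation_in_D[OF \<omega>]])
      fix n
      have "\<bar>spread (X (Suc n) \<omega>) - spread (X n \<omega>)\<bar> \<le> K * (1 / real (Suc n))"
        by (rule K(1)[OF occupation_in_D[OF \<omega>] occupation_in_D[OF \<omega>] occupation_slow[OF \<omega>]])
      \<comment> \<open>Enlarging the constant by the factor \<open>Suc N\<close> matches the
        denominator to the one in the summability statement.\<close>
      also have "\<dots> \<le> K * (real (Suc N) / real (N + Suc n))"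
      proof (rule mult_left_mono[OF _ \<open>K \<ge> 0\<close>])
        show "1 / real (Suc n) \<le> real (Suc N) / real (N + Suc n)"
          by (simp add: field_simps)
      qed
      finally show "\<bar>spread (X (Suc n) \<omega>) - spread (X n \<omega>)\<bar> \<le> (K * real (Suc N)) / real (N + Suc n)"
        by simp
    qed
  qed
qed

subsection \<open>The limit set\<close>

lemma sets_limit_set_fixed: "{\<omega> \<in> space M. limit_set (\<lambda>n. X n \<omega>) \<subseteq> Fix} \<in> sets M"
proof -
  have "{\<omega> \<in> space M. limit_set (\<lambda>n. X n \<omega>) \<subseteq> Fix} =
      {\<omega> \<in> space M. (\<lambda>n. spread (X n \<omega>)) \<longlonglongrightarrow> 0}"
    by (intro Collect_cong conj_cong refl trajectory_limit_set_fixed_iff occupation_in_D)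
  also have "\<dots> \<in> sets M" by measurable
  finally show ?thesis .
qed

lemma AE_limit_set_fixed: "AE \<omega> in M. limit_set (\<lambda>n. X n \<omega>) \<subseteq> Fix"
  using AE_spread_tendsto_0
proof (rule AE_mp, intro AE_I2 impI)
  fix \<omega> assume "\<omega> \<in> space M" "(\<lambda>n. spread (X n \<omega>)) \<longlonglongrightarrow> 0"
  then show "limit_set (\<lambda>n. X n \<omega>) \<subseteq> Fix"
    using trajectory_limit_set_fixed_iff[of "\<lambda>n. X n \<omega>"] occupation_in_D by blast
qed

text \<open>The step bound is deterministic, so connectedness holds at every sample point.\<close>

lemma limit_set_connected:
  assumes "\<omega> \<in> space M"
  shows "connected (limit_set (\<lambda>n. X n \<omega>))"
  by (rule trajectory_limit_set_connected[OF occupation_in_D[OF assms] occupation_slow[OF assms]])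

text \<open>Compactness makes every limit set nonempty, and almost all of them lie in
  \<open>Fix\<close>; a probability space is not a null set, so some trajectory exhibits a fixed
  point.\<close>

lemma fixed_points_nonempty: "Fix \<noteq> {}"
proof
  assume "Fix = {}"
  have "AE \<omega> in M. False"
    using AE_limit_set_fixed
  proof (rule AE_mp, intro AE_I2 impI)
    fix \<omega> assume "\<omega> \<in> space M" "limit_set (\<lambda>n. X n \<omega>) \<subseteq> Fix"
    then show False
      using trajectory_limit_set_nonempty[of "\<lambda>n. X n \<omega>"] occupation_in_D \<open>Fix = {}\<close> by blast
  qed
  then show False using AE_E_prob by auto
qed

lemma sets_tendsto:
  assumes "x \<in> Fix"
  shows "{\<omega> \<in> space M. (\<lambda>n. X n \<omega>) \<longlonglongrightarrow> x} \<in> sets M"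
proof -
  have x: "x \<in> coord_space m V" using assms by (auto simp: fixed_points_def simplex_prod_def)
  have "{\<omega> \<in> space M. (\<lambda>n. X n \<omega>) \<longlonglongrightarrow> x} =
      {\<omega> \<in> space M. \<forall>p\<in>C. (\<lambda>n. X n \<omega> (fst p) (snd p)) \<longlonglongrightarrow> x (fst p) (snd p)}"
    by (intro Collect_cong conj_cong refl tendsto_coord_space_iff[unfolded case_prod_unfold] occupation_in_D x)
  also have "\<dots> \<in> sets M" using finite_C by measurable
  finally show ?thesis .
qed

text \<open>The convergence events are disjoint because limits are unique in each coordinate, and
  almost every trajectory lies in one of them.\<close>

lemma sum_prob_tendsto:
  assumes fin: "finite Fix"
  shows "(\<Sum>x\<in>Fix. \<P>(\<omega> in M. (\<lambda>n. X n \<omega>) \<longlonglongrightarrow> x)) = 1"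
proof -
  let ?A = "\<lambda>x. {\<omega> \<in> space M. (\<lambda>n. X n \<omega>) \<longlonglongrightarrow> x}"
  have "disjoint_family_on ?A Fix"
  proof -
    have "x = y" if "(\<lambda>n. X n \<omega>) \<longlonglongrightarrow> x" "(\<lambda>n. X n \<omega>) \<longlonglongrightarrow> y" for x y \<omega>
      using that LIMSEQ_unique unfolding tendsto_fun_iff by (intro ext) blast
    then show ?thesis by (auto simp: disjoint_family_on_def)
  qed
  then have "(\<Sum>x\<in>Fix. prob (?A x)) = prob (\<Union>x\<in>Fix. ?A x)"
    using fin sets_tendsto by (intro finite_measure_finite_Union[symmetric]) auto
  moreover have "AE \<omega> in M. \<omega> \<in> (\<Union>x\<in>Fix. ?A x)"
    using AE_limit_set_fixed
  proof (rule AE_mp, intro AE_I2 impI)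
    fix \<omega> assume \<omega>: "\<omega> \<in> space M" "limit_set (\<lambda>n. X n \<omega>) \<subseteq> Fix"
    show "\<omega> \<in> (\<Union>x\<in>Fix. ?A x)"
      using trajectory_converges[OF occupation_in_D[OF \<omega>(1)] occupation_slow[OF \<omega>(1)] fin \<omega>(2)] \<omega>(1)
      by blast
  qed
  then have "prob (\<Union>x\<in>Fix. ?A x) = 1"
    using fin sets_tendsto by (intro prob_eq_1[THEN iffD2] sets.finite_UN) auto
  ultimately show ?thesis by simp
qed

end

theorem theorem1:
  fixes m :: nat
    and V :: "nat \<Rightarrow> 'v set"
    and \<alpha> :: real
    and \<eta> :: "nat \<Rightarrow> 'v \<Rightarrow> real"
    and \<rho> :: "nat \<Rightarrow> nat \<Rightarrow> 'v \<Rightarrow> real"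
    and M :: "'w measure"
    and W :: "nat \<Rightarrow> nat \<Rightarrow> 'w \<Rightarrow> 'v"
    and b :: "(nat \<Rightarrow> 'v set) \<Rightarrow> nat \<Rightarrow> 'v"
  defines "X \<equiv> occupation m V W"
    and "Fix \<equiv> fixed_points m V \<alpha> \<eta> \<rho>"
  assumes m: "m \<ge> 1"
    and V: "\<And>i. i \<in> {1..m} \<Longrightarrow> finite (V i) \<and> V i \<noteq> {}"
    and \<alpha>: "\<alpha> > 0"
    and \<eta>: "\<And>v i. i \<in> walks_at m V v \<Longrightarrow> \<eta> i v > 0"
    and \<rho>_sym: "\<And>v i j. i \<in> walks_at m V v \<Longrightarrow> j \<in> walks_at m V v \<Longrightarrow> \<rho> i j v = \<rho> j i v"
    and \<eta>_\<rho>: "\<And>v i. i \<in> walks_at m V v \<Longrightarrow>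
              \<eta> i v > (\<Sum>j | j \<in> walks_at m V v \<and> \<rho> i j v < 0. \<bar>\<rho> i j v\<bar>)"
    and M: "prob_space M"
    and W: "\<And>i n. i \<in> {1..m} \<Longrightarrow> n \<ge> 1 \<Longrightarrow> W i n \<in> measurable M (count_space (V i))"
    and W_step: "\<And>i v n. i \<in> {1..m} \<Longrightarrow> v \<in> V i \<Longrightarrow>
              (AE \<omega> in M. real_cond_exp M (walk_history M m V W n)
                   (indicat_real {\<omega> \<in> space M. W i (n + 1) \<omega> = v}) \<omega> =
                 transition m V \<alpha> \<eta> \<rho> (X n \<omega>) i v)"
    and W_indep: "\<And>n. cond_indep_vars M (walk_history M m V W n)
              (\<lambda>i. count_space (V i)) (\<lambda>i. W i (n + 1)) {1..m}"
    and b: "\<And>S i. S \<in> supports m V \<Longrightarrow> (\<forall>k\<in>{1..m}. S k \<noteq> {}) \<Longrightarrow> i \<in> {1..m} \<Longrightarrow> b S i \<in> S i"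
  shows "(Fix = (\<Union>S\<in>supports m V. positive_solutions m V \<eta> \<rho> S) \<and>
            finite (supports m V) \<and>
            (\<forall>S\<in>supports m V. connected (positive_solutions m V \<eta> \<rho> S))) \<and>
         Fix \<noteq> {} \<and>
         (AE \<omega> in M. connected (limit_set (\<lambda>n. X n \<omega>))) \<and>
         \<P>(\<omega> in M. limit_set (\<lambda>n. X n \<omega>) \<subseteq> Fix) = 1 \<and>
         ((\<forall>S\<in>supports m V. (\<forall>i\<in>{1..m}. S i \<noteq> {}) \<longrightarrow>
              Determinant.det (system_matrix m V \<rho> (b S) S) \<noteq> 0) \<longrightarrow>
            finite Fix \<and>
            (\<Sum>x\<in>Fix. \<P>(\<omega> in M. (\<lambda>n. X n \<omega>) \<longlonglongrightarrow> x)) = 1)"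
proof -
  interpret P: prob_space M by (rule M)
  interpret reinforced_walks m V \<alpha> \<eta> \<rho> M W
    by unfold_locales (use V \<alpha> \<rho>_sym \<eta>_\<rho> W W_step in \<open>auto simp: X_def\<close>)
  have "\<P>(\<omega> in M. limit_set (\<lambda>n. X n \<omega>) \<subseteq> Fix) = 1"
    unfolding X_def Fix_def using sets_limit_set_fixed AE_limit_set_fixed
    by (simp add: P.prob_Collect_eq_1)
  moreover have "AE \<omega> in M. connected (limit_set (\<lambda>n. X n \<omega>))"
    unfolding X_def by (intro AE_I2 limit_set_connected)
  moreover have "finite Fix \<and> (\<Sum>x\<in>Fix. \<P>(\<omega> in M. (\<lambda>n. X n \<omega>) \<longlonglongrightarrow> x)) = 1"
    if det: "\<forall>S\<in>supports m V. (\<forall>i\<in>{1..m}. S i \<noteq> {}) \<longrightarrow>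
      Determinant.det (system_matrix m V \<rho> (b S) S) \<noteq> 0"
  proof -
    have "finite Fix"
      unfolding Fix_def by (rule finite_fixed_points[of b]) (use b det in blast)+
    then show ?thesis using sum_prob_tendsto by (simp add: X_def Fix_def)
  qed
  ultimately show ?thesis
    using fixed_points_eq finite_supports connected_positive_solutions fixed_points_nonempty
    unfolding Fix_def by blast
qed

end
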